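(* Consider a project (as defined in the context) satisfying: (PCLI1) $g(x,z)>0$ for every $x\in\mathsf X$ and $z\in\overline{\mathbb R}$; (PCLI2) the MP index $m(x)=f(x,x)/g(x,x)$ is nondecreasing and continuous on $\mathsf X$. Assume further that for each state $x\in\mathsf X$ there is a countable partition $\{S_i(x):i\in N(x)\}$ of $\mathbb R$, with each $S_i(x)$ being either a left-semiclosed interval or a singleton, such that: (i) $F(x,\cdot)=\sum_{i\in N(x)}F_i(x,\cdot)1_{S_i(x)}(\cdot)$ and $G(x,\cdot)=\sum_{i\in N(x)}G_i(x,\cdot)1_{S_i(x)}(\cdot)$ on $\mathbb R$, with $F_i(x,\cdot)$ and $G_i(x,\cdot)$ both differentiable on the interior $\mathring S_i(x)$ of $S_i(x)$; (ii) $F_2'(x,z)=m(z)\,G_2'(x,z)$ for $z\in\mathring S_i(x)$ and $i\in N(x)$, where $F_2'$ and $G_2'$ denote the partial derivatives of $F(x,z)$ and $G(x,z)$ with respect to $z$. Then, for every $x\in\mathsf X$ and all $-\infty<z_1<z_2<\infty$, $$F(x,z_2)-F(x,z_1)=\int_{(z_1,z_2]}m(z)\,G(x,dz).$$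
   Context: Project model. $\mathsf X=\{x\in\mathbb R:\ell\le x\le u\}$ with $-\infty\le\ell<u\le\infty$; all sets and functions are Borel measurable. A project has state $X_t\in\mathsf X$ and action $A_t\in\{0,1\}$ ($1$ = active, $0$ = passive) at times $t=0,1,\dots$. When $(X_t,A_t)=(x,a)$ it yields reward $r(x,a)$, consumes $c(x,a)$ units of a resource, and $X_{t+1}\sim\kappa^a(x,\cdot)$, with $\kappa^0,\kappa^1$ Markov transition kernels on $\mathsf X$. The discount factor is $\beta\in[0,1)$. Standing assumption: for each $a\in\{0,1\}$, $r(\cdot,a)$ and $c(\cdot,a)$ are continuous on $\mathsf X$, $0\le c(x,0)<c(x,1)$ for all $x$, and there are a function $w:\mathsf X\to[1,\infty)$ and constants $M>0$, $\beta\le\gamma<1$ with $\max\{|r(x,a)|,c(x,a)\}\le M w(x)$ and $\beta\int w(y)\,\kappa^a(x,dy)\le\gamma w(x)$ for all $x,a$. Policies and metrics. For a nonanticipative policy $\pi$ and $X_0=x$, $F(x,\pi)=\mathsf E_x^\pi[\sum_{t\ge0}\beta^t r(X_t,A_t)]$, $G(x,\pi)=\mathsf E_x^\pi[\sum_{t\ge0}\beta^t c(X_t,A_t)]$. For $z\in\overline{\mathbb R}=\mathbb R\cup\{-\infty,\infty\}$ the $z$-policy takes $A_t=1$ iff $X_t>z$; its metrics are $F(x,z),G(x,z)$, and $F(x,\cdot),G(x,\cdot)$ denote them as functions of $z\in\mathbb R$. For an action $a$ and a policy $\pi$, $\langle a,\pi\rangle$ takes action $a$ at time $0$ and follows $\pi$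 afterwards. $f(x,\pi)=F(x,\langle1,\pi\rangle)-F(x,\langle0,\pi\rangle)$, $g(x,\pi)=G(x,\langle1,\pi\rangle)-G(x,\langle0,\pi\rangle)$; $f(x,z),g(x,z)$ are these for the $z$-policy. The integral is a Lebesgue–Stieltjes integral with respect to $z\mapsto G(x,z)$ on $\mathbb R$ (mass $G(x,b)-G(x,a)$ on $(a,b]$). $m$ is extended to $\mathbb R$ by $m(z)=m(\ell)$ for $z<\ell$ and $m(z)=m(u)$ for $z>u$. A left-semiclosed interval is a set $\{z\in\mathbb R:a\le z<b\}$ with $-\infty\le a<b\le\infty$. *)

theory Defs
  imports "HOL-Probability.Probability"
begin

section \<open>Projects with a real-valued state\<close>

text \<open>Actions are Booleans: \<^term>\<open>True\<close> is active (1), \<^term>\<open>False\<close> is passive (0).\<close>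

record project =
  lower :: ereal
  upper :: ereal
  reward :: "real \<Rightarrow> bool \<Rightarrow> real"
  cost :: "real \<Rightarrow> bool \<Rightarrow> real"
  kernel :: "bool \<Rightarrow> real \<Rightarrow> real measure"
  disc :: real

definition states :: "project \<Rightarrow> real set" where
  "states p = {x. lower p \<le> ereal x \<and> ereal x \<le> upper p}"

definition state_space :: "project \<Rightarrow> real measure" where
  "state_space p = restrict_space borel (states p)"

definition step_space :: "project \<Rightarrow> (real \<times> bool) measure" where
  "step_space p = state_space p \<Otimes>\<^sub>M count_space UNIV"

text \<open>The weighted drift condition uses the nonnegative integral, so that it cannot hold merely
  because a Bochner integral of a non-integrable function is 0.\<close>

definition restless_project :: "project \<Rightarrow> bool" where
  "restless_project p \<longleftrightarrow>
     lower p < upper p \<and>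
     0 \<le> disc p \<and> disc p < 1 \<and>
     (\<forall>a. kernel p a \<in> state_space p \<rightarrow>\<^sub>M prob_algebra (state_space p)) \<and>
     (\<forall>a. continuous_on (states p) (\<lambda>x. reward p x a)) \<and>
     (\<forall>a. continuous_on (states p) (\<lambda>x. cost p x a)) \<and>
     (\<forall>x\<in>states p. 0 \<le> cost p x False \<and> cost p x False < cost p x True) \<and>
     (\<exists>w M \<gamma>. w \<in> borel_measurable (state_space p) \<and> (\<forall>x\<in>states p. 1 \<le> w x) \<and>
        0 < M \<and> disc p \<le> \<gamma> \<and> \<gamma> < 1 \<and>
        (\<forall>x\<in>states p. \<forall>a.
           max \<bar>reward p x a\<bar> (cost p x a) \<le> M * w x \<and>
           ennreal (disc p) * (\<integral>\<^sup>+y. ennreal (w y) \<partial>kernel p a x) \<le> ennreal (\<gamma> * w x)))"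

section \<open>Policies and the controlled process\<close>

text \<open>A (randomized, history-dependent) policy maps the time \<open>t\<close>, the history
  \<open>(X\<^sub>i, A\<^sub>i)\<close> for \<open>i < t\<close> and the current state \<open>X\<^sub>t\<close> to the law of \<open>A\<^sub>t\<close>.\<close>

type_synonym policy = "nat \<Rightarrow> (nat \<Rightarrow> real \<times> bool) \<Rightarrow> real \<Rightarrow> bool measure"

definition nonanticipative :: "project \<Rightarrow> policy \<Rightarrow> bool" where
  "nonanticipative p \<pi> \<longleftrightarrow>
     (\<forall>t. (\<lambda>(h, y). \<pi> t h y) \<in>
        (PiM {0..<t} (\<lambda>_. step_space p) \<Otimes>\<^sub>M state_space p) \<rightarrow>\<^sub>M prob_algebra (count_space UNIV))"

definition threshold :: "ereal \<Rightarrow> policy" where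
  "threshold z = (\<lambda>t h y. return (count_space UNIV) (z < ereal y))"

text \<open>\<open>first_then a \<pi>\<close> is \<open>\<langle>a, \<pi>\<rangle>\<close>: from time 1 on, \<open>\<pi>\<close> sees only the time and history since time 1.\<close>

definition first_then :: "bool \<Rightarrow> policy \<Rightarrow> policy" where
  "first_then a \<pi> = (\<lambda>t h y. case t of
       0 \<Rightarrow> return (count_space UNIV) a
     | Suc s \<Rightarrow> \<pi> s (\<lambda>i\<in>{0..<s}. h (Suc i)) y)"

text \<open>Conditional law of \<open>(X\<^sub>t, A\<^sub>t)\<close> given the history \<open>h\<close>, when \<open>X\<^sub>0 = x\<close>.\<close>

definition step_kernel ::
    "project \<Rightarrow> policy \<Rightarrow> real \<Rightarrow> nat \<Rightarrow> (nat \<Rightarrow> real \<times> bool) \<Rightarrow> (real \<times> bool) measure" where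
  "step_kernel p \<pi> x t h =
     (case t of
        0 \<Rightarrow> return (state_space p) x
      | Suc s \<Rightarrow> kernel p (snd (h s)) (fst (h s)))
     \<bind> (\<lambda>y. distr (\<pi> t h y) (step_space p) (Pair y))"

text \<open>Law of the trajectory \<open>(X\<^sub>t, A\<^sub>t)\<^sub>t\<close>, given by the Ionescu-Tulcea theorem.\<close>

definition trajectory :: "project \<Rightarrow> policy \<Rightarrow> real \<Rightarrow> (nat \<Rightarrow> real \<times> bool) measure" where
  "trajectory p \<pi> x =
     projective_family.lim UNIV
       (Ionescu_Tulcea.CI (step_kernel p \<pi> x) (\<lambda>_. step_space p)) (\<lambda>_. step_space p)"

lemma sets_step_space [measurable_cong]: "sets (step_space p) = sets (state_space p \<Otimes>\<^sub>M count_space UNIV)"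
  by (simp add: step_space_def)

lemma nonanticipative_threshold: "nonanticipative p (threshold z)"
  unfolding nonanticipative_def
proof
  fix t
  have sm: "(\<lambda>y. z < ereal y) \<in> state_space p \<rightarrow>\<^sub>M count_space UNIV"
    unfolding state_space_def by (rule measurable_restrict_space1) measurable
  have r: "return (count_space UNIV) \<in> count_space UNIV \<rightarrow>\<^sub>M prob_algebra (count_space (UNIV :: bool set))"
    by (rule measurable_return_prob_space)
  show "(\<lambda>(h, y). threshold z t h y) \<in>
        (PiM {0..<t} (\<lambda>_. step_space p) \<Otimes>\<^sub>M state_space p) \<rightarrow>\<^sub>M prob_algebra (count_space UNIV)"
    using measurable_compose[OF measurable_compose[OF measurable_snd sm] r]
    by (simp add: threshold_def split_beta')
qed

lemma nonanticipative_first_then: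
  assumes pi: "nonanticipative p \<pi>"
  shows "nonanticipative p (first_then a \<pi>)"
  unfolding nonanticipative_def
proof
  fix t
  show "(\<lambda>(h, y). first_then a \<pi> t h y) \<in>
        (PiM {0..<t} (\<lambda>_. step_space p) \<Otimes>\<^sub>M state_space p) \<rightarrow>\<^sub>M prob_algebra (count_space UNIV)"
  proof (cases t)
    case 0
    have "return (count_space UNIV) a \<in> space (prob_algebra (count_space UNIV))"
      by (auto simp: space_prob_algebra prob_space_return)
    then show ?thesis by (simp add: first_then_def 0)
  next
    case (Suc s)
    have pim: "(\<lambda>(h, y). \<pi> s h y) \<in>
        (PiM {0..<s} (\<lambda>_. step_space p) \<Otimes>\<^sub>M state_space p) \<rightarrow>\<^sub>M prob_algebra (count_space UNIV)"
      using pi by (auto simp: nonanticipative_def)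
    have 1: "(\<lambda>q. (\<lambda>i\<in>{0..<s}. fst q (Suc i))) \<in>
       (PiM {0..<Suc s} (\<lambda>_. step_space p) \<Otimes>\<^sub>M state_space p) \<rightarrow>\<^sub>M PiM {0..<s} (\<lambda>_. step_space p)"
      by (rule measurable_restrict,
          rule measurable_compose[OF measurable_fst measurable_component_singleton]) auto
    have "(\<lambda>q. ((\<lambda>i\<in>{0..<s}. fst q (Suc i)), snd q)) \<in>
       (PiM {0..<Suc s} (\<lambda>_. step_space p) \<Otimes>\<^sub>M state_space p) \<rightarrow>\<^sub>M
       PiM {0..<s} (\<lambda>_. step_space p) \<Otimes>\<^sub>M state_space p"
      by (rule measurable_Pair[OF 1 measurable_snd])
    from measurable_compose[OF this pim] show ?thesis
      by (simp add: first_then_def Suc split_beta')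
  qed
qed
lemma Ionescu_Tulcea_step_kernel:
  assumes p: "restless_project p" and pi: "nonanticipative p \<pi>" and x: "x \<in> states p"
  shows "Ionescu_Tulcea (step_kernel p \<pi> x) (\<lambda>_. step_space p)"
proof -
  have K: "step_kernel p \<pi> x t \<in> PiM {0..<t} (\<lambda>_. step_space p) \<rightarrow>\<^sub>M prob_algebra (step_space p)" for t
  proof -
    have pim: "(\<lambda>(h, y). \<pi> t h y) \<in>
        (PiM {0..<t} (\<lambda>_. step_space p) \<Otimes>\<^sub>M state_space p) \<rightarrow>\<^sub>M prob_algebra (count_space UNIV)"
      using pi by (auto simp: nonanticipative_def)
    have km: "kernel p a \<in> state_space p \<rightarrow>\<^sub>M prob_algebra (state_space p)" for a
      using p by (auto simp: restless_project_def)
    have xs: "x \<in> space (state_space p)"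
      using x by (simp add: state_space_def space_restrict_space)
    have 1: "(\<lambda>h. case t of 0 \<Rightarrow> return (state_space p) x | Suc s \<Rightarrow> kernel p (snd (h s)) (fst (h s)))
       \<in> PiM {0..<t} (\<lambda>_. step_space p) \<rightarrow>\<^sub>M prob_algebra (state_space p)"
    proof (cases t)
      case 0
      have "return (state_space p) x \<in> space (prob_algebra (state_space p))"
        using xs by (auto simp: space_prob_algebra prob_space_return)
      then show ?thesis using 0 by simp
    next
      case (Suc s)
      have c: "(\<lambda>h. h s) \<in> PiM {0..<Suc s} (\<lambda>_. step_space p) \<rightarrow>\<^sub>M state_space p \<Otimes>\<^sub>M count_space UNIV"
        using measurable_component_singleton[of s "{0..<Suc s}" "\<lambda>_. step_space p"]
        by (simp add: step_space_def)
      have "(\<lambda>q. kernel p (snd q) (fst q)) \<in> state_space p \<Otimes>\<^sub>M count_space UNIV \<rightarrow>\<^sub>M prob_algebra (state_space p)"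
        by (rule measurable_compose_countable'[where g=snd and I=UNIV])
           (auto intro: measurable_compose[OF measurable_fst km])
      from measurable_compose[OF c this] show ?thesis by (simp add: Suc)
    qed
    have 2: "(\<lambda>(h, y). distr (\<pi> t h y) (step_space p) (Pair y)) \<in>
        (PiM {0..<t} (\<lambda>_. step_space p) \<Otimes>\<^sub>M state_space p) \<rightarrow>\<^sub>M prob_algebra (step_space p)"
    proof -
      have "(\<lambda>q. distr (\<pi> t (fst q) (snd q)) (step_space p) (\<lambda>a. (snd q, a)))
        \<in> (PiM {0..<t} (\<lambda>_. step_space p) \<Otimes>\<^sub>M state_space p) \<rightarrow>\<^sub>M prob_algebra (step_space p)"
        by (rule measurable_distr_prob_space2[where M="count_space UNIV"])
           (use pim in \<open>simp_all add: split_beta' step_space_def\<close>)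
      then show ?thesis by (simp add: split_beta')
    qed
    show ?thesis
      unfolding step_kernel_def[abs_def]
      using measurable_bind_prob_space2[OF 1 2] by simp
  qed
  show ?thesis
    unfolding Ionescu_Tulcea_def
    using measurable_prob_algebraD[OF K] measurable_space[OF K] by (auto simp: space_prob_algebra)
qed

section \<open>Performance metrics and the marginal productivity index\<close>

definition reward_metric :: "project \<Rightarrow> real \<Rightarrow> policy \<Rightarrow> real" where
  "reward_metric p x \<pi> =
     (\<integral>\<omega>. (\<Sum>t. disc p ^ t * reward p (fst (\<omega> t)) (snd (\<omega> t))) \<partial>trajectory p \<pi> x)"

definition resource_metric :: "project \<Rightarrow> real \<Rightarrow> policy \<Rightarrow> real" where
  "resource_metric p x \<pi> =
     (\<integral>\<omega>. (\<Sum>t. disc p ^ t * cost p (fst (\<omega> t)) (snd (\<omega> t))) \<partial>trajectory p \<pi> x)"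

definition marginal_reward :: "project \<Rightarrow> real \<Rightarrow> policy \<Rightarrow> real" where
  "marginal_reward p x \<pi> =
     reward_metric p x (first_then True \<pi>) - reward_metric p x (first_then False \<pi>)"

definition marginal_resource :: "project \<Rightarrow> real \<Rightarrow> policy \<Rightarrow> real" where
  "marginal_resource p x \<pi> =
     resource_metric p x (first_then True \<pi>) - resource_metric p x (first_then False \<pi>)"

definition mp_index :: "project \<Rightarrow> real \<Rightarrow> real" where
  "mp_index p x =
     marginal_reward p x (threshold (ereal x)) / marginal_resource p x (threshold (ereal x))"

text \<open>A real number can lie below \<^term>\<open>lower p\<close> or above \<^term>\<open>upper p\<close> only if that endpoint is
  finite.\<close>

definition mp_index_ext :: "project \<Rightarrow> real \<Rightarrow> real" where
  "mp_index_ext p z =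
     (if ereal z < lower p then mp_index p (real_of_ereal (lower p))
      else if upper p < ereal z then mp_index p (real_of_ereal (upper p))
      else mp_index p z)"

section \<open>Lebesgue-Stieltjes integrals\<close>

text \<open>The integrator \<open>G\<close> need not be nondecreasing (the resource metric is typically nonincreasing
  in the threshold), so it is written as a difference of two nondecreasing right-continuous
  functions; the value does not depend on the decomposition.\<close>

definition has_LS_integral :: "(real \<Rightarrow> real) \<Rightarrow> (real \<Rightarrow> real) \<Rightarrow> real set \<Rightarrow> real \<Rightarrow> bool" where
  "has_LS_integral h G A I \<longleftrightarrow>
     (\<exists>P N. mono P \<and> mono N \<and>
        (\<forall>z. continuous (at_right z) P) \<and> (\<forall>z. continuous (at_right z) N) \<and>
        (\<forall>z. G z = P z - N z) \<and>
        set_integrable (interval_measure P) A h \<and> set_integrable (interval_measure N) A h \<and>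
        I = (LINT z:A|interval_measure P. h z) - (LINT z:A|interval_measure N. h z))"

section \<open>Pieces of the partitions of the threshold line\<close>

definition left_semiclosed :: "real set \<Rightarrow> bool" where
  "left_semiclosed J \<longleftrightarrow> (\<exists>a b :: ereal. a < b \<and> J = {z. a \<le> ereal z \<and> ereal z < b})"

end

theory Submission
  imports Defs
begin

text \<open>
  Let \<open>V z\<close> be the value of the \<open>z\<close>-policy for any one-step payoff bounded by the weight
  \<open>w\<close>. If \<open>Z n\<close> tends to \<open>z\<close> and, in each state, the actions of the \<open>Z n\<close>-policies are
  eventually equal to an action with which the \<open>z\<close>-policy may start without changing its value, then the discrepancy
  \<open>V (Z n) - V z\<close> satisfies a contraction inequality in the limit, so it vanishes. For \<open>Z n\<close> decreasing to
  \<open>z\<close> this gives right-continuity of \<open>F\<close> and \<open>G\<close>. For \<open>Z n\<close> increasing to \<open>z\<close> the actions change only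
  in the state \<open>z\<close> itself, where \<open>m z\<close> is the resource price that makes both actions equally good; so
  \<open>F - m z * G\<close> is left-continuous at \<open>z\<close>, that is, the jumps of \<open>F\<close> are \<open>m\<close> times those of \<open>G\<close>.
  The same contraction and (PCLI1) show that \<open>G\<close> is nonincreasing. Hence \<open>F\<close> minus the indefinite
  Stieltjes integral of \<open>m\<close> is continuous, and its derivative is 0 off the countable set of points
  interior to no piece, so it is constant.
\<close>

section \<open>Increments as Stieltjes integrals\<close>

text \<open>After a small tilt \<open>f\<close> becomes \<open>g\<close> with negative derivative off \<open>D\<close>; some level \<open>y\<close> is missed by
  \<open>g ` D\<close>, and \<open>g\<close> cannot cross \<open>y\<close> upwards for the last time.\<close>

lemma DERIV_zero_off_countable_le:
  fixes f :: "real \<Rightarrow> real"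
  assumes ab: "a < b" and cont: "continuous_on {a..b} f" and D: "countable D"
    and deriv: "\<And>x. x \<in> {a<..<b} - D \<Longrightarrow> DERIV f x :> 0"
  shows "f b \<le> f a"
proof (rule ccontr)
  assume "\<not> f b \<le> f a"
  then have fab: "f a < f b" by simp
  \<comment> \<open>The tilt uses up exactly half of the increment of \<open>f\<close>, so
    \<open>g\<close> still has \<open>g a < g b\<close> while its derivative off \<open>D\<close> is
    \<open>-\<epsilon>\<close>.\<close>
  define \<epsilon> where "\<epsilon> = (f b - f a) / (2 * (b - a))"
  have \<epsilon>: "\<epsilon> > 0" using fab ab by (simp add: \<epsilon>_def)
  have \<epsilon>2: "\<epsilon> * (b - a) = (f b - f a) / 2" using ab by (simp add: \<epsilon>_def nonzero_divide_eq_eq divide_simps)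
  define g where "g x = f x - \<epsilon> * x" for x
  have "g b - g a = (f b - f a) / 2"
    using \<epsilon>2 by (simp add: g_def right_diff_distrib)
  then have gab: "g a < g b" using fab by simp
  have gc: "continuous_on {a..b} g"
    unfolding g_def by (intro continuous_intros cont)
  have "uncountable {g a<..<g b}" using gab by (simp add: uncountable_open_interval)
  then have "\<not> {g a<..<g b} \<subseteq> g ` D"
    using D countable_image countable_subset by blast
  then obtain y where y: "g a < y" "y < g b" "y \<notin> g ` D" by (force simp: subset_iff)
  define T where "T = {x \<in> {a..b}. g x \<le> y}"
  have aT: "a \<in> T" using y ab by (auto simp: T_def)
  have clT: "closed T"
  proof -
    have "T = {a..b} \<inter> g -` {..y}" by (auto simp: T_def)
    then show ?thesis
      using continuous_on_closed_vimage[of "{a..b}" g] gc by (metis closed_atLeastAtMost closed_atMost Int_commute)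
  qed
  have bdd: "bdd_above T" by (rule bdd_aboveI[of _ b]) (auto simp: T_def)
  define s where "s = Sup T"
  have sT: "s \<in> T" unfolding s_def using aT bdd clT by (intro closed_contains_Sup) auto
  have above: "g x > y" if "s < x" "x \<le> b" for x
    using cSup_upper[OF _ bdd, of x] that sT by (force simp: T_def s_def)
  have sb: "s < b" using sT y by (cases "s = b") (auto simp: T_def)
  have gs: "g s = y"
  proof (rule ccontr)
    assume "g s \<noteq> y"
    then have "g s < y" using sT by (auto simp: T_def)
    moreover have "continuous_on {s..b} g"
      by (rule continuous_on_subset[OF gc]) (use sT in \<open>auto simp: T_def\<close>)
    ultimately obtain x where "s \<le> x" "x \<le> b" "g x = y"
      using IVT'[of g s y b] sb y by auto
    then show False using above[of x] \<open>g s < y\<close> by (cases "x = s") auto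
  qed
  have "s \<notin> D" using gs y by auto
  moreover have "s > a" using gs y sT by (cases "s = a") (auto simp: T_def)
  ultimately have "DERIV f s :> 0" using sb by (intro deriv) auto
  then have "DERIV g s :> - \<epsilon>"
    unfolding g_def by (auto intro!: derivative_eq_intros)
  from DERIV_neg_dec_right[OF this] \<epsilon>
  obtain d where d: "d > 0" "\<And>h. h > 0 \<Longrightarrow> h < d \<Longrightarrow> g (s + h) < g s" by auto
  \<comment> \<open>Small enough for the decrease of \<open>g\<close> at \<open>s\<close>, and
    \<open>s + h\<close> stays in \<open>{a..b}\<close>, where every point right of \<open>s\<close>
    has a value above \<open>y = g s\<close>.\<close>
  define h where "h = min (d/2) (b - s)"
  have "h > 0" "h < d" "s + h \<le> b" using d sb by (auto simp: h_def)
  then show False using d(2)[of h] above[of "s+h"] gs by auto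
qed

text \<open>The exceptional set may be dense, so the mean value theorem cannot be applied between
  neighbouring exceptional points; the one-sided lemma is used for \<open>f\<close> and for
  \<open>- f\<close> instead.\<close>

lemma DERIV_zero_off_countable_const:
  fixes f :: "real \<Rightarrow> real"
  assumes "a < b" "continuous_on {a..b} f" "countable D"
    and "\<And>x. x \<in> {a<..<b} - D \<Longrightarrow> DERIV f x :> 0"
  shows "f b = f a"
proof (rule antisym)
  show "f b \<le> f a" by (rule DERIV_zero_off_countable_le[OF assms])
  have "- f b \<le> - f a"
    using assms
    by (intro DERIV_zero_off_countable_le[where D=D]) (auto intro!: continuous_intros derivative_eq_intros)
  then show "f a \<le> f b" by simp
qed

section \<open>Stieltjes integrals of monotone integrands\<close>

lemma set_integrable_interval_measure:
  fixes m P :: "real \<Rightarrow> real"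
  assumes m: "mono m" and P: "mono P" "\<And>z. continuous (at_right z) P"
  shows "set_integrable (interval_measure P) {a<..b} m"
proof -
  have [measurable]: "m \<in> borel_measurable borel" using m by (rule borel_measurable_mono)
  have fin: "emeasure (interval_measure P) {a<..b} < \<infinity>"
    by (subst emeasure_interval_measure_Ioc_eq) (use P in \<open>auto dest: monoD\<close>)
  show ?thesis
    unfolding set_integrable_def
  proof (rule integrableI_bounded_set[where A="{a<..b}" and B="\<bar>m a\<bar> + \<bar>m b\<bar>"])
    have "\<bar>m x\<bar> \<le> \<bar>m a\<bar> + \<bar>m b\<bar>" if "a < x" "x \<le> b" for x
      using monoD[OF m, of a x] monoD[OF m, of x b] that by auto
    then show "AE x in interval_measure P. x \<in> {a<..b} \<longrightarrow>
        norm (indicat_real {a<..b} x *\<^sub>R m x) \<le> \<bar>m a\<bar> + \<bar>m b\<bar>"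
      by (auto split: split_indicator)
  qed (use fin in auto)
qed

text \<open>On \<open>{a<..b}\<close> the integrand lies between \<open>m a\<close> and
  \<open>m b\<close>, and the interval has mass \<open>P b - P a\<close>. The increment formula uses
  the integral only through these bounds and additivity.\<close>

lemma set_integral_interval_measure_bounds:
  fixes m P :: "real \<Rightarrow> real"
  assumes m: "mono m" and P: "mono P" "\<And>z. continuous (at_right z) P" and ab: "a \<le> b"
  shows "m a * (P b - P a) \<le> (LINT z:{a<..b}|interval_measure P. m z)"
    and "(LINT z:{a<..b}|interval_measure P. m z) \<le> m b * (P b - P a)"
proof -
  have em: "emeasure (interval_measure P) {a<..b} = ennreal (P b - P a)"
    using ab P by (intro emeasure_interval_measure_Ioc) (auto dest: monoD)
  have me: "measure (interval_measure P) {a<..b} = P b - P a"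
    using monoD[OF P(1) ab] by (simp add: measure_def em)
  have ind: "integrable (interval_measure P) (indicat_real {a<..b})"
    by (rule integrable_real_indicator) (auto simp: em)
  have ci: "set_integrable (interval_measure P) {a<..b} (\<lambda>_. c)" for c :: real
    unfolding set_integrable_def using ind by (rule integrable_scaleR_left)
  have c: "(LINT z:{a<..b}|interval_measure P. c) = c * (P b - P a)" for c :: real
    unfolding set_lebesgue_integral_def
    by (subst integral_scaleR_left) (simp_all add: ind me[unfolded measure_def] measure_def)
  have i: "set_integrable (interval_measure P) {a<..b} m"
    by (rule set_integrable_interval_measure[OF m P])
  have "(LINT z:{a<..b}|interval_measure P. m a) \<le> (LINT z:{a<..b}|interval_measure P. m z)"
    using ci i by (rule set_integral_mono) (auto intro: monoD[OF m])
  then show "m a * (P b - P a) \<le> (LINT z:{a<..b}|interval_measure P. m z)"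
    by (simp only: c)
  have "(LINT z:{a<..b}|interval_measure P. m z) \<le> (LINT z:{a<..b}|interval_measure P. m b)"
    using i ci by (rule set_integral_mono) (auto intro: monoD[OF m])
  then show "(LINT z:{a<..b}|interval_measure P. m z) \<le> m b * (P b - P a)"
    by (simp only: c)
qed

text \<open>Near \<open>z\<close> the indefinite integral \<open>J\<close> changes like
  \<open>m z * P\<close>, with an error of at most the product of the increments of \<open>m\<close>
  and \<open>P\<close>. By continuity of \<open>m\<close> the error tends to 0, and it is of smaller
  order than \<open>y - z\<close> where \<open>P\<close> is differentiable. So \<open>F - J\<close>
  inherits from \<open>F - m z * P\<close> continuity everywhere and derivative 0 off
  \<open>D\<close>.\<close>

lemma stieltjes_integral_eq_increment:
  fixes F P m :: "real \<Rightarrow> real"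
  assumes m: "mono m" "continuous_on UNIV m"
    and P: "mono P" "\<And>z. continuous (at_right z) P"
    and F: "\<And>z. continuous (at_right z) F"
    and jump: "\<And>z. ((\<lambda>y. F y - m z * P y) \<longlongrightarrow> F z - m z * P z) (at_left z)"
    and D: "countable D"
    and diff: "\<And>z. z \<notin> D \<Longrightarrow> F differentiable at z" "\<And>z. z \<notin> D \<Longrightarrow> P differentiable at z"
    and deriv: "\<And>z. z \<notin> D \<Longrightarrow> deriv F z = m z * deriv P z"
    and ab: "a < b"
  shows "(LINT z:{a<..b}|interval_measure P. m z) = F b - F a"
proof -
  \<comment> \<open>The integral starts left of \<open>a\<close>, so that \<open>J\<close> obeys the
    estimates on both sides of \<open>a\<close> and two-sided continuity of \<open>H\<close> covers
    the endpoint.\<close>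
  define c where "c = a - 1"
  define J where "J z = (LINT y:{c<..z}|interval_measure P. m y)" for z
  have J_diff: "J z - J y = (LINT y:{y<..z}|interval_measure P. m y)" if "c \<le> y" "y \<le> z" for y z
  proof -
    have "{c<..z} = {c<..y} \<union> {y<..z}" using that by auto
    then have "J z = J y + (LINT y:{y<..z}|interval_measure P. m y)"
      unfolding J_def by (simp only:)
        (rule set_integral_Un; auto intro!: set_integrable_interval_measure m P)
    then show ?thesis by simp
  qed
  have est1: "\<bar>J z - J y - m z * (P z - P y)\<bar> \<le> \<bar>m z - m y\<bar> * \<bar>P z - P y\<bar>"
     "\<bar>J z - J y - m y * (P z - P y)\<bar> \<le> \<bar>m z - m y\<bar> * \<bar>P z - P y\<bar>"
    if "c \<le> y" "y \<le> z" for y z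
    using set_integral_interval_measure_bounds[OF m(1) P that(2)] J_diff[OF that]
      monoD[OF m(1) that(2)] monoD[OF P(1) that(2)]
    by (auto simp: algebra_simps abs_if)
  have est: "\<bar>J y - J z - m z * (P y - P z)\<bar> \<le> \<bar>m y - m z\<bar> * \<bar>P y - P z\<bar>"
    if "c \<le> y" "c \<le> z" for y z
  proof (cases "y \<le> z")
    case True
    have "\<bar>J y - J z - m z * (P y - P z)\<bar> = \<bar>J z - J y - m z * (P z - P y)\<bar>"
      by (simp add: algebra_simps abs_if)
    then show ?thesis using est1(1)[OF that(1) True] by (simp add: abs_minus_commute)
  qed (use est1(2)[of z y] that in simp)
  define e where "e z y = J y - J z - m z * (P y - P z)" for z y
  have ev_c: "\<forall>\<^sub>F y in at z. c \<le> y" if "c < z" for z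
    using that order_less_imp_le
    by (metis (mono_tags, lifting) eventually_mono order_tendstoD(1) tendsto_ident_at)
  have m_tends: "(m \<longlongrightarrow> m z) (at z)" for z
    using m(2) by (auto simp: continuous_on_eq_continuous_at isCont_def)
  have e_0: "(e z \<longlongrightarrow> 0) (at z)" if "c < z" for z
  proof -
    \<comment> \<open>\<open>P\<close> may jump at \<open>z\<close>, so monotonicity only keeps its
      increment bounded; the factor coming from \<open>m\<close> makes the product small.\<close>
    have P_bd: "\<forall>\<^sub>F y in at z. \<bar>P y - P z\<bar> \<le> P (z + 1) - P (z - 1)"
    proof -
      have "\<forall>\<^sub>F y in at z. y \<in> {z - 1<..<z + 1}"
        by (rule eventually_at_in_open') auto
      then show ?thesis
      proof eventually_elim
        case (elim y)
        have "P (z-1) \<le> P y" "P y \<le> P (z+1)" "P (z-1) \<le> P z" "P z \<le> P (z+1)"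
          using elim by (auto intro!: monoD[OF P(1)])
        then show ?case by linarith
      qed
    qed
    show ?thesis
    proof (rule Lim_null_comparison)
      show "\<forall>\<^sub>F y in at z. norm (e z y) \<le> \<bar>m y - m z\<bar> * (P (z + 1) - P (z - 1))"
        using P_bd ev_c[OF that]
      proof eventually_elim
        case (elim y)
        have "\<bar>m y - m z\<bar> * \<bar>P y - P z\<bar> \<le> \<bar>m y - m z\<bar> * (P (z + 1) - P (z - 1))"
          using elim by (intro mult_left_mono) auto
        then show ?case using est[of y z] elim that
          by (simp add: e_def)
      qed
      show "((\<lambda>y. \<bar>m y - m z\<bar> * (P (z + 1) - P (z - 1))) \<longlongrightarrow> 0) (at z)"
        using m_tends[of z] by (auto intro!: tendsto_eq_intros)
    qed
  qed
  define H where "H z = F z - J z" for z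
  have H_eq: "H y - H z = (F y - m z * P y) - (F z - m z * P z) - e z y" for y z
    by (simp add: H_def e_def algebra_simps)
  have H_eq': "H = (\<lambda>y. H z + ((F y - m z * P y) - (F z - m z * P z) - e z y))" for z
    using H_eq[of _ z] by (auto simp: fun_eq_iff algebra_simps)
  have H_cont: "isCont H z" if "c < z" for z
  proof -
    have L: "(e z \<longlongrightarrow> 0) (at_left z)" "(e z \<longlongrightarrow> 0) (at_right z)"
      using e_0[OF that] by (auto simp: filterlim_at_split)
    \<comment> \<open>From the right \<open>F\<close> and \<open>P\<close> converge separately; from
      the left only the combination in \<open>jump\<close> is known to converge.\<close>
    have R: "((\<lambda>y. F y - m z * P y) \<longlongrightarrow> F z - m z * P z) (at_right z)"
      using F[of z] P(2)[of z] by (auto simp: continuous_within intro!: tendsto_intros)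
    have H_lim: "(H \<longlongrightarrow> H z) G"
      if "((\<lambda>y. F y - m z * P y) \<longlongrightarrow> F z - m z * P z) G" "(e z \<longlongrightarrow> 0) G" for G
    proof (subst H_eq'[of z])
      show "((\<lambda>y. H z + (F y - m z * P y - (F z - m z * P z) - e z y)) \<longlongrightarrow> H z) G"
        using tendsto_add[OF tendsto_const tendsto_diff[OF tendsto_diff[OF that(1) tendsto_const] that(2)],
            of "H z" "F z - m z * P z"] by simp
    qed
    show ?thesis
      using H_lim[OF jump L(1)] H_lim[OF R L(2)] by (auto simp: isCont_def filterlim_at_split)
  qed
  have H_deriv: "DERIV H z :> 0" if "c < z" "z \<notin> D" for z
  proof -
    have DF: "DERIV F z :> m z * deriv P z"
      using diff(1)[OF that(2)] deriv[OF that(2)] by (metis DERIV_deriv_iff_real_differentiable)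
    have DP: "DERIV P z :> deriv P z"
      using diff(2)[OF that(2)] by (metis DERIV_deriv_iff_real_differentiable)
    have De: "DERIV (e z) z :> 0"
      unfolding has_field_derivative_iff
    proof (rule Lim_null_comparison)
      have "(\<lambda>y. (P y - P z) / (y - z)) \<midarrow>z\<rightarrow> deriv P z"
        using DP by (simp add: has_field_derivative_iff)
      from tendsto_mult[OF tendsto_rabs[OF tendsto_diff[OF m_tends[of z] tendsto_const[of "m z"]]]
          tendsto_rabs[OF this]]
      show "((\<lambda>y. \<bar>m y - m z\<bar> * \<bar>(P y - P z) / (y - z)\<bar>) \<longlongrightarrow> 0) (at z)"
        by simp
      show "\<forall>\<^sub>F y in at z. norm ((e z y - e z z) / (y - z)) \<le> \<bar>m y - m z\<bar> * \<bar>(P y - P z) / (y - z)\<bar>"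
        using ev_c[OF that(1)]
      proof eventually_elim
        case (elim y)
        then show ?case
          using est[of y z] that
          by (auto simp: e_def abs_mult intro!: divide_right_mono)
      qed
    qed
    show ?thesis
      using DERIV_add[OF DERIV_const[of "H z"]
          DERIV_diff[OF DERIV_diff[OF DERIV_diff[OF DF DERIV_cmult[OF DP, of "m z"]]
            DERIV_const[of "F z - m z * P z"]] De]]
      by (subst H_eq'[of z]) simp
  qed
  have "H b = H a"
    using H_cont H_deriv ab
    by (intro DERIV_zero_off_countable_const[OF ab _ D])
       (auto simp: c_def intro!: continuous_at_imp_continuous_on)
  then show ?thesis
    using J_diff[of a b] ab by (simp add: H_def c_def)
qed

section \<open>Marginals of the controlled process\<close>

text \<open>Coordinate \<open>t\<close> depends only on the times in \<open>{0..<Suc t}\<close>, and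
  the projection of the limit measure to these times is the finite composition
  \<open>C\<close>.\<close>

lemma (in Ionescu_Tulcea) nn_integral_lim_component:
  assumes f[measurable]: "f \<in> borel_measurable (M t)"
  shows "(\<integral>\<^sup>+\<omega>. f (\<omega> t) \<partial>PF.lim) = (\<integral>\<^sup>+\<omega>. f (\<omega> t) \<partial>C 0 (Suc t) (\<lambda>_. undefined))"
proof -
  let ?J = "{0..<Suc t}"
  \<comment> \<open>\<open>CI\<close> on an index set is a projection of \<open>C\<close> run up to
    the least bound of that set, which for \<open>?J\<close> is \<open>Suc t\<close>.\<close>
  have up: "up_to ?J = Suc t"
    using up_to_iff[of ?J "Suc t"] up_to_less[of ?J t] by auto
  have f': "(\<lambda>\<omega>. f (\<omega> t)) \<in> borel_measurable (PiM ?J M)"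
    using measurable_compose[OF measurable_component_singleton[of t "{0..<Suc t}" M] f] by simp
  have C0: "sets (C 0 (Suc t) (\<lambda>_. undefined)) = sets (PiM ?J M)"
    by (subst sets_C) (auto simp: space_PiM)
  have r: "(\<lambda>\<omega>. restrict \<omega> ?J) \<in> measurable PF.lim (PiM ?J M)"
    by (subst measurable_cong_sets[OF PF.sets_lim refl]) (rule measurable_restrict_subset, simp)
  have r': "(\<lambda>\<omega>. restrict \<omega> ?J) \<in> measurable (C 0 (Suc t) (\<lambda>_. undefined)) (PiM ?J M)"
    by (subst measurable_cong_sets[OF C0 refl]) (rule measurable_restrict_subset, simp)
  have "(\<integral>\<^sup>+\<omega>. f (\<omega> t) \<partial>PF.lim) = (\<integral>\<^sup>+\<omega>. f (\<omega> t) \<partial>distr PF.lim (PiM ?J M) (\<lambda>\<omega>. restrict \<omega> ?J))"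
    by (subst nn_integral_distr[OF r]) (simp_all add: f')
  also have "\<dots> = (\<integral>\<^sup>+\<omega>. f (\<omega> t) \<partial>CI ?J)"
    by (simp add: distr_lim)
  also have "\<dots> = (\<integral>\<^sup>+\<omega>. f (\<omega> t) \<partial>C 0 (Suc t) (\<lambda>_. undefined))"
    unfolding CI_def up by (subst nn_integral_distr[OF r']) (simp_all add: f')
  finally show ?thesis .
qed

text \<open>The last stage of \<open>C\<close> appends one coordinate drawn from \<open>P t\<close>,
  which can be integrated out first.\<close>

lemma (in Ionescu_Tulcea) nn_integral_C_component:
  assumes f[measurable]: "f \<in> borel_measurable (M t)"
  shows "(\<integral>\<^sup>+\<omega>. f (\<omega> t) \<partial>C 0 (Suc t) (\<lambda>_. undefined)) =
    (\<integral>\<^sup>+\<omega>. (\<integral>\<^sup>+y. f y \<partial>P t \<omega>) \<partial>C 0 t (\<lambda>_. undefined))"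
proof -
  have f': "(\<lambda>\<omega>. f (\<omega> t)) \<in> borel_measurable (PiM {0..<Suc t} M)"
    using measurable_compose[OF measurable_component_singleton[of t "{0..<Suc t}" M] f] by simp
  have u: "(\<lambda>_. undefined) \<in> space (PiM {0..<0} M)" by (simp add: space_PiM)
  have C0: "sets (C 0 t (\<lambda>_. undefined)) = sets (PiM {0..<t} M)"
    using sets_C[OF u] by simp
  have eP: "eP t \<in> measurable (C 0 t (\<lambda>_. undefined)) (subprob_algebra (PiM {0..<Suc t} M))"
    by (subst measurable_cong_sets[OF C0 refl]) (rule measurable_eP)
  have "(\<integral>\<^sup>+\<omega>. f (\<omega> t) \<partial>C 0 (Suc t) (\<lambda>_. undefined)) =
      (\<integral>\<^sup>+\<omega>. (\<integral>\<^sup>+y. f (y t) \<partial>eP t \<omega>) \<partial>C 0 t (\<lambda>_. undefined))"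
    using nn_integral_bind[OF f' eP] by simp
  also have "\<dots> = (\<integral>\<^sup>+\<omega>. (\<integral>\<^sup>+y. f y \<partial>P t \<omega>) \<partial>C 0 t (\<lambda>_. undefined))"
  proof (rule nn_integral_cong)
    fix \<omega> assume "\<omega> \<in> space (C 0 t (\<lambda>_. undefined))"
    then have "\<omega> \<in> space (PiM {0..<t} M)" using sets_eq_imp_space_eq[OF C0] by simp
    from nn_integral_eP[OF this f'] show "(\<integral>\<^sup>+y. f (y t) \<partial>eP t \<omega>) = (\<integral>\<^sup>+y. f y \<partial>P t \<omega>)"
      by simp
  qed
  finally show ?thesis .
qed

text \<open>Markov operator on state-action pairs: the current action is part of the argument and
  only the next one is set by the threshold. Its powers at \<open>(x, a)\<close> therefore describe
  the policy that starts with \<open>a\<close> and then follows \<open>z\<close>.\<close>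

definition step_op :: "project \<Rightarrow> real \<Rightarrow> (real \<times> bool \<Rightarrow> ennreal) \<Rightarrow> real \<times> bool \<Rightarrow> ennreal" where
  "step_op p z \<phi> = (\<lambda>q. \<integral>\<^sup>+y. \<phi> (y, z < y) \<partial>kernel p (snd q) (fst q))"

locale project_model =
  fixes p :: project
  assumes project: "restless_project p"
begin

lemma space_state_space [simp]: "space (state_space p) = states p"
  by (simp add: state_space_def space_restrict_space)

lemma kernel_measurable: "kernel p a \<in> state_space p \<rightarrow>\<^sub>M prob_algebra (state_space p)"
  using project by (auto simp: restless_project_def)

lemma sets_kernel: "x \<in> states p \<Longrightarrow> sets (kernel p a x) = sets (state_space p)"
  and prob_space_kernel: "x \<in> states p \<Longrightarrow> prob_space (kernel p a x)"
  using measurable_space[OF kernel_measurable, of x] by (auto simp: space_prob_algebra)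

lemma space_kernel: "x \<in> states p \<Longrightarrow> space (kernel p a x) = states p"
  using sets_eq_imp_space_eq[OF sets_kernel] by simp

lemma space_step_space: "space (step_space p) = states p \<times> UNIV"
  by (simp add: step_space_def space_pair_measure)

lemma pair_kernel_measurable:
  "(\<lambda>q. kernel p (snd q) (fst q)) \<in> step_space p \<rightarrow>\<^sub>M subprob_algebra (state_space p)"
  unfolding step_space_def
  by (rule measurable_compose_countable'[where g=snd and I=UNIV])
     (auto intro: measurable_compose[OF measurable_fst measurable_prob_algebraD[OF kernel_measurable]])

lemma measurable_threshold_action:
  "(\<lambda>y. (y, z < y)) \<in> state_space p \<rightarrow>\<^sub>M step_space p"
proof -
  have "(\<lambda>y. z < y) \<in> state_space p \<rightarrow>\<^sub>M count_space UNIV"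
    unfolding state_space_def by (rule measurable_restrict_space1) measurable
  then show ?thesis unfolding step_space_def by measurable
qed

lemma step_op_measurable:
  assumes "\<phi> \<in> borel_measurable (step_space p)"
  shows "step_op p z \<phi> \<in> borel_measurable (step_space p)"
  unfolding step_op_def
  by (rule nn_integral_measurable_subprob_algebra2[where N="state_space p"])
     (use measurable_compose[OF measurable_snd measurable_compose[OF measurable_threshold_action assms]]
      in \<open>auto intro!: pair_kernel_measurable simp: split_beta'\<close>)

lemma funpow_step_op_measurable:
  assumes "\<phi> \<in> borel_measurable (step_space p)"
  shows "(step_op p z ^^ n) \<phi> \<in> borel_measurable (step_space p)"
  by (induction n) (auto intro: step_op_measurable assms)

lemma distr_return_Pair:
  "y \<in> states p \<Longrightarrow>
    distr (return (count_space UNIV) b) (step_space p) (Pair y) = return (step_space p) (y, b)"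
  unfolding step_space_def by (intro distr_return measurable_Pair1') simp_all

text \<open>The action is a deterministic function \<open>s\<close> of the state, so the inner law
  is a point mass. A constant \<open>s\<close> covers the prescribed first action, the threshold
  rule all later ones.\<close>

lemma nn_integral_step_kernel:
  assumes X: "prob_space X" "sets X = sets (state_space p)"
    and \<phi>: "\<phi> \<in> borel_measurable (step_space p)"
    and s: "(\<lambda>y. (y, s y)) \<in> state_space p \<rightarrow>\<^sub>M step_space p"
  shows "(\<integral>\<^sup>+q. \<phi> q \<partial>(X \<bind> (\<lambda>y. distr (return (count_space UNIV) (s y)) (step_space p) (Pair y)))) =
    (\<integral>\<^sup>+y. \<phi> (y, s y) \<partial>X)"
proof -
  have sp: "space X = states p" using sets_eq_imp_space_eq[OF X(2)] by simp
  have eq: "X \<bind> (\<lambda>y. distr (return (count_space UNIV) (s y)) (step_space p) (Pair y)) =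
      X \<bind> (\<lambda>y. return (step_space p) (y, s y))"
    by (intro bind_cong refl) (simp add: sp distr_return_Pair)
  have m: "(\<lambda>y. return (step_space p) (y, s y)) \<in> X \<rightarrow>\<^sub>M subprob_algebra (step_space p)"
    by (subst measurable_cong_sets[OF X(2) refl])
       (rule measurable_compose[OF s return_measurable])
  have "(y, s y) \<in> space (step_space p)" if "y \<in> states p" for y
    using that by (simp add: space_step_space)
  then show ?thesis
    unfolding eq nn_integral_bind[OF \<phi> m]
    by (intro nn_integral_cong nn_integral_return \<phi>) (simp add: sp)
qed

text \<open>Integrating out the last transition replaces \<open>\<phi>\<close> by
  \<open>step_op p z \<phi>\<close> at the previous time, hence the induction over \<open>t\<close>
  with \<open>\<phi>\<close> arbitrary.\<close>

lemma nn_integral_trajectory: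
  assumes x: "x \<in> states p" and \<phi>: "\<phi> \<in> borel_measurable (step_space p)"
  shows "(\<integral>\<^sup>+\<omega>. \<phi> (\<omega> t) \<partial>trajectory p (first_then a (threshold (ereal z))) x) =
    (step_op p z ^^ t) \<phi> (x, a)"
proof -
  define \<pi> where "\<pi> = first_then a (threshold (ereal z))"
  interpret IT: Ionescu_Tulcea "step_kernel p \<pi> x" "\<lambda>_. step_space p"
    unfolding \<pi>_def
    by (intro Ionescu_Tulcea_step_kernel project nonanticipative_first_then nonanticipative_threshold x)
  have first: "step_kernel p \<pi> x 0 h =
      return (state_space p) x \<bind> (\<lambda>y. distr (return (count_space UNIV) a) (step_space p) (Pair y))" for h
    by (simp add: step_kernel_def \<pi>_def first_then_def)
  have later: "step_kernel p \<pi> x (Suc s) h =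
      kernel p (snd (h s)) (fst (h s)) \<bind>
        (\<lambda>y. distr (return (count_space UNIV) (z < y)) (step_space p) (Pair y))" for s h
    by (simp add: step_kernel_def \<pi>_def first_then_def threshold_def)
  have xp: "prob_space (return (state_space p) x)"
    using x by (intro prob_space_return) simp
  have u: "(\<lambda>_. undefined) \<in> space (PiM {0..<0::nat} (\<lambda>_. step_space p))" by (simp add: space_PiM)
  have "(\<integral>\<^sup>+\<omega>. \<phi> (\<omega> t) \<partial>IT.C 0 (Suc t) (\<lambda>_. undefined)) = (step_op p z ^^ t) \<phi> (x, a)"
    using \<phi>
  proof (induction t arbitrary: \<phi>)
    case 0
    have s: "(\<lambda>y. (y, a)) \<in> state_space p \<rightarrow>\<^sub>M step_space p"
      unfolding step_space_def by simp
    \<comment> \<open>\<open>C 0 0\<close> is the point mass at the empty history, so only the first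
      step kernel contributes.\<close>
    show ?case
      using x measurable_compose[OF s 0] nn_integral_return[OF u, of "\<lambda>_. \<phi> (x, a)"]
      by (subst IT.nn_integral_C_component[OF 0])
         (simp add: nn_integral_return first nn_integral_step_kernel[OF xp _ 0 s]
           del: nn_integral_const nn_integral_cmult)
  next
    case (Suc t)
    have "(\<integral>\<^sup>+\<omega>. \<phi> (\<omega> (Suc t)) \<partial>IT.C 0 (Suc (Suc t)) (\<lambda>_. undefined)) =
        (\<integral>\<^sup>+\<omega>. (\<integral>\<^sup>+y. \<phi> y \<partial>step_kernel p \<pi> x (Suc t) \<omega>) \<partial>IT.C 0 (Suc t) (\<lambda>_. undefined))"
      by (rule IT.nn_integral_C_component[OF Suc.prems])
    also have "\<dots> = (\<integral>\<^sup>+\<omega>. step_op p z \<phi> (\<omega> t) \<partial>IT.C 0 (Suc t) (\<lambda>_. undefined))"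
    proof (rule nn_integral_cong)
      fix \<omega> assume "\<omega> \<in> space (IT.C 0 (Suc t) (\<lambda>_. undefined))"
      then have "\<omega> \<in> space (PiM {0..<Suc t} (\<lambda>_. step_space p))"
        using IT.space_C[OF u, of "Suc t"] by simp
      then have "\<omega> t \<in> states p \<times> UNIV"
        using space_step_space by (auto simp: space_PiM PiE_iff)
      then have "fst (\<omega> t) \<in> states p" by auto
      then show "(\<integral>\<^sup>+y. \<phi> y \<partial>step_kernel p \<pi> x (Suc t) \<omega>) = step_op p z \<phi> (\<omega> t)"
        unfolding later step_op_def
        by (intro nn_integral_step_kernel prob_space_kernel sets_kernel Suc.prems measurable_threshold_action)
    qed
    also have "\<dots> = (step_op p z ^^ t) (step_op p z \<phi>) (x, a)"
      by (rule Suc.IH[OF step_op_measurable[OF Suc.prems]])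
    finally show ?case by (simp add: funpow_swap1)
  qed
  then show ?thesis
    using IT.nn_integral_lim_component[OF \<phi>] by (simp add: trajectory_def \<pi>_def)
qed

lemma sets_trajectory:
  assumes x: "x \<in> states p"
  shows "sets (trajectory p (first_then a (threshold z)) x) = sets (PiM UNIV (\<lambda>_. step_space p))"
proof -
  interpret IT: Ionescu_Tulcea "step_kernel p (first_then a (threshold z)) x" "\<lambda>_. step_space p"
    by (intro Ionescu_Tulcea_step_kernel project nonanticipative_first_then nonanticipative_threshold x)
  show ?thesis unfolding trajectory_def by (rule IT.PF.sets_lim)
qed

text \<open>The initial state is deterministic, so the threshold rule amounts to a prescribed first
  action; afterwards nothing changes, because the rule ignores time and history. This turns the
  metrics of the \<open>z\<close>-policy into action values.\<close>

lemma trajectory_threshold: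
  assumes x: "x \<in> states p"
  shows "trajectory p (threshold z) x = trajectory p (first_then (z < ereal x) (threshold z)) x"
proof -
  have "step_kernel p (threshold z) x t h = step_kernel p (first_then (z < ereal x) (threshold z)) x t h" for t h
  proof (cases t)
    \<comment> \<open>At time 0 the two rules differ as functions of the state and agree only after
      averaging over the point mass at \<open>x\<close>.\<close>
    case 0
    have m: "(\<lambda>y. distr (return (count_space UNIV) (b y)) (step_space p) (Pair y)) \<in>
        state_space p \<rightarrow>\<^sub>M subprob_algebra (step_space p)"
      if "(\<lambda>y. (y, b y)) \<in> state_space p \<rightarrow>\<^sub>M step_space p" for b :: "real \<Rightarrow> bool"
    proof -
      have "(\<lambda>y. return (step_space p) (y, b y)) \<in> state_space p \<rightarrow>\<^sub>M subprob_algebra (step_space p)"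
        by (rule measurable_compose[OF that return_measurable])
      then show ?thesis
        by (subst measurable_cong[where g="\<lambda>y. return (step_space p) (y, b y)"])
          (simp_all add: distr_return_Pair)
    qed
    have "(\<lambda>y. z < ereal y) \<in> state_space p \<rightarrow>\<^sub>M count_space UNIV"
      unfolding state_space_def by (rule measurable_restrict_space1) measurable
    then have 1: "(\<lambda>y. (y, z < ereal y)) \<in> state_space p \<rightarrow>\<^sub>M step_space p"
      unfolding step_space_def by measurable
    have 2: "(\<lambda>y. (y, z < ereal x)) \<in> state_space p \<rightarrow>\<^sub>M step_space p"
      unfolding step_space_def by simp
    show ?thesis
      using x bind_return[OF m[OF 1], of x] bind_return[OF m[OF 2], of x]
      by (simp add: 0 step_kernel_def first_then_def threshold_def)
  next
    case (Suc s)
    then show ?thesis by (simp add: step_kernel_def first_then_def threshold_def)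
  qed
  then have "step_kernel p (threshold z) x = step_kernel p (first_then (z < ereal x) (threshold z)) x"
    by (intro ext)
  then show ?thesis by (simp add: trajectory_def)
qed

end

section \<open>Contraction and action values\<close>

locale drift_model = project_model +
  fixes w :: "real \<Rightarrow> real" and \<gamma> :: real
  assumes w_measurable: "w \<in> borel_measurable (state_space p)"
    and w_ge_1: "x \<in> states p \<Longrightarrow> 1 \<le> w x"
    and \<gamma>: "0 \<le> \<gamma>" "\<gamma> < 1"
    and drift: "x \<in> states p \<Longrightarrow>
      ennreal (disc p) * (\<integral>\<^sup>+y. ennreal (w y) \<partial>kernel p a x) \<le> ennreal (\<gamma> * w x)"
begin

lemma disc: "0 \<le> disc p" "disc p < 1"
  using project by (auto simp: restless_project_def)

lemma measurable_kernel: "x \<in> states p \<Longrightarrow> borel_measurable (kernel p a x) = borel_measurable (state_space p)"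
  by (rule measurable_cong_sets[OF sets_kernel refl])

text \<open>The discount factor is kept in front of the integral, which may itself be infinite when
  that factor is 0.\<close>

lemma drift_mult:
  assumes x: "x \<in> states p" and K: "0 \<le> K"
    and f: "\<And>y. y \<in> states p \<Longrightarrow> f y \<le> ennreal (K * w y)"
  shows "ennreal (disc p) * (\<integral>\<^sup>+y. f y \<partial>kernel p a x) \<le> ennreal (\<gamma> * K * w x)"
proof -
  have "(\<integral>\<^sup>+y. f y \<partial>kernel p a x) \<le> (\<integral>\<^sup>+y. ennreal K * ennreal (w y) \<partial>kernel p a x)"
    using K f by (intro nn_integral_mono) (simp add: space_kernel[OF x] ennreal_mult')
  also have "\<dots> = ennreal K * (\<integral>\<^sup>+y. ennreal (w y) \<partial>kernel p a x)"
    by (rule nn_integral_cmult) (simp add: measurable_kernel[OF x] measurable_compose[OF w_measurable measurable_ennreal])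
  finally have "ennreal (disc p) * (\<integral>\<^sup>+y. f y \<partial>kernel p a x) \<le>
      ennreal K * (ennreal (disc p) * (\<integral>\<^sup>+y. ennreal (w y) \<partial>kernel p a x))"
    by (metis mult_left_mono zero_le mult.left_commute)
  also have "\<dots> \<le> ennreal K * ennreal (\<gamma> * w x)"
    by (intro mult_left_mono drift x) simp
  also have "\<dots> = ennreal (\<gamma> * K * w x)"
    using K by (simp add: ennreal_mult'[symmetric] ac_simps)
  finally show ?thesis .
qed

text \<open>Each use of \<open>step\<close> improves the bound by the factor
  \<open>\<gamma>\<close>, whichever action it provides, so \<open>L\<close> lies below
  \<open>\<gamma> ^ n * K * w\<close> for every \<open>n\<close>.\<close>

lemma contraction_zero:
  assumes bound: "\<And>y. y \<in> states p \<Longrightarrow> L y \<le> ennreal (K * w y)" and K: "0 \<le> K"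
    and step: "\<And>y. y \<in> states p \<Longrightarrow> \<exists>a. L y \<le> ennreal (disc p) * (\<integral>\<^sup>+u. L u \<partial>kernel p a y)"
    and x: "x \<in> states p"
  shows "L x = (0 :: ennreal)"
proof -
  have b: "L y \<le> ennreal (\<gamma> ^ n * K * w y)" if "y \<in> states p" for n y
    using that
  proof (induction n arbitrary: y)
    case (Suc n)
    obtain a where "L y \<le> ennreal (disc p) * (\<integral>\<^sup>+u. L u \<partial>kernel p a y)"
      using step[OF Suc.prems] by auto
    also have "\<dots> \<le> ennreal (\<gamma> * (\<gamma> ^ n * K) * w y)"
      using Suc K \<gamma> by (intro drift_mult) auto
    finally show ?case by (simp add: ac_simps)
  qed (use bound in simp)
  have "(\<lambda>n. \<gamma> ^ n * (K * w x)) \<longlonglongrightarrow> 0 * (K * w x)"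
    using \<gamma> by (intro tendsto_intros LIMSEQ_power_zero) auto
  then have "(\<lambda>n. ennreal (\<gamma> ^ n * K * w x)) \<longlonglongrightarrow> ennreal 0"
    by (intro tendsto_ennrealI) (simp add: mult.assoc)
  then have "L x \<le> ennreal 0"
    by (rule LIMSEQ_le_const) (use b[OF x] in auto)
  then show ?thesis by simp
qed

section \<open>Weighted bounds, discounted totals and their recursion\<close>

definition w_bounded :: "real \<Rightarrow> (real \<Rightarrow> real) \<Rightarrow> bool" where
  "w_bounded K f \<longleftrightarrow> 0 \<le> K \<and> f \<in> borel_measurable (state_space p) \<and> (\<forall>y\<in>states p. \<bar>f y\<bar> \<le> K * w y)"

text \<open>If the discount factor is 0, the drift condition does not make \<open>w\<close> integrable; Bochner integrals
  are then possibly junk, but they only occur multiplied by the discount factor.\<close>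

lemma w_bounded_integrable:
  assumes "w_bounded K f" "disc p \<noteq> 0" and x: "x \<in> states p"
  shows "integrable (kernel p a x) f"
proof (rule integrableI_bounded)
  show "f \<in> borel_measurable (kernel p a x)"
    using assms by (simp add: w_bounded_def measurable_kernel[OF x])
  have "ennreal (disc p) * (\<integral>\<^sup>+y. ennreal (norm (f y)) \<partial>kernel p a x) \<le> ennreal (\<gamma> * K * w x)"
    using assms by (intro drift_mult x) (auto simp: w_bounded_def intro!: ennreal_leI)
  also have "\<dots> < \<infinity>" by simp
  finally show "(\<integral>\<^sup>+y. ennreal (norm (f y)) \<partial>kernel p a x) < \<infinity>"
    using assms(2) disc by (auto simp: ennreal_mult_less_top)
qed

text \<open>Expected discounted total of a nonnegative payoff. Values in \<open>ennreal\<close>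
  allow sums and integrals to be interchanged before finiteness is known.\<close>

definition total_value :: "real \<Rightarrow> (real \<times> bool \<Rightarrow> ennreal) \<Rightarrow> real \<times> bool \<Rightarrow> ennreal" where
  "total_value z \<phi> q = (\<Sum>t. ennreal (disc p ^ t) * (step_op p z ^^ t) \<phi> q)"

lemma total_value_measurable:
  assumes "\<phi> \<in> borel_measurable (step_space p)"
  shows "total_value z \<phi> \<in> borel_measurable (step_space p)"
  unfolding total_value_def[abs_def]
  by (intro borel_measurable_suminf_order borel_measurable_times_ennreal funpow_step_op_measurable assms) simp_all

text \<open>Split off the term \<open>t = 0\<close>. Every later term carries one discount factor
  and one kernel, and the interchange of sum and integral reassembles the rest into a total from the
  next state.\<close>

lemma total_value_rec:
  assumes \<phi>: "\<phi> \<in> borel_measurable (step_space p)" and x: "x \<in> states p"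
  shows "total_value z \<phi> (x, a) =
    \<phi> (x, a) + ennreal (disc p) * (\<integral>\<^sup>+y. total_value z \<phi> (y, z < y) \<partial>kernel p a x)"
proof -
  let ?f = "\<lambda>t. ennreal (disc p ^ t) * (step_op p z ^^ t) \<phi> (x, a)"
  have m: "(\<lambda>y. (step_op p z ^^ t) \<phi> (y, z < y)) \<in> borel_measurable (kernel p a x)" for t
    unfolding measurable_kernel[OF x]
    by (rule measurable_compose[OF measurable_threshold_action funpow_step_op_measurable[OF \<phi>]])
  have "?f (Suc t) = ennreal (disc p) *
      (\<integral>\<^sup>+y. ennreal (disc p ^ t) * (step_op p z ^^ t) \<phi> (y, z < y) \<partial>kernel p a x)" for t
    using disc by (subst nn_integral_cmult[OF m]) (simp add: step_op_def ennreal_mult' mult.assoc)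
  then have "(\<Sum>t. ?f (Suc t)) = ennreal (disc p) *
      (\<Sum>t. \<integral>\<^sup>+y. ennreal (disc p ^ t) * (step_op p z ^^ t) \<phi> (y, z < y) \<partial>kernel p a x)"
    by simp
  also have "\<dots> = ennreal (disc p) * (\<integral>\<^sup>+y. total_value z \<phi> (y, z < y) \<partial>kernel p a x)"
    unfolding total_value_def using m by (subst nn_integral_suminf) auto
  finally have eq: "(\<Sum>t. ?f (Suc t)) =
      ennreal (disc p) * (\<integral>\<^sup>+y. total_value z \<phi> (y, z < y) \<partial>kernel p a x)" .
  have "(\<lambda>t. ?f (Suc t)) sums (\<Sum>t. ?f (Suc t))"
    by (rule summable_sums[OF summableI])
  from sums_unique[OF sums_Suc[OF this]] have "suminf ?f = (\<Sum>t. ?f (Suc t)) + ?f 0"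
    by (rule sym)
  then have "total_value z \<phi> (x, a) = (\<Sum>t. ?f (Suc t)) + ?f 0"
    by (simp only: total_value_def)
  then show ?thesis
    unfolding eq by (simp add: add.commute)
qed

text \<open>Applying the drift condition \<open>t\<close> times bounds the term at time
  \<open>t\<close> by \<open>\<gamma> ^ t * K * w x\<close>; the constant is the sum of the
  geometric series.\<close>

lemma total_value_le:
  assumes m\<phi>: "\<phi> \<in> borel_measurable (step_space p)"
    and K: "0 \<le> K" and \<phi>: "\<And>x a. x \<in> states p \<Longrightarrow> \<phi> (x, a) \<le> ennreal (K * w x)"
    and x: "x \<in> states p"
  shows "total_value z \<phi> (x, a) \<le> ennreal (K / (1 - \<gamma>) * w x)"
proof -
  have b: "ennreal (disc p ^ t) * (step_op p z ^^ t) \<phi> (x, a) \<le> ennreal (\<gamma> ^ t * K * w x)"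
    if "x \<in> states p" for t x a
    using that
  proof (induction t arbitrary: x a)
    case (Suc t)
    have "ennreal (disc p ^ Suc t) * (step_op p z ^^ Suc t) \<phi> (x, a) =
        ennreal (disc p) * (ennreal (disc p ^ t) * (\<integral>\<^sup>+y. (step_op p z ^^ t) \<phi> (y, z < y) \<partial>kernel p a x))"
      using disc by (simp add: step_op_def ennreal_mult' mult.assoc)
    also have "\<dots> = ennreal (disc p) * (\<integral>\<^sup>+y. ennreal (disc p ^ t) * (step_op p z ^^ t) \<phi> (y, z < y) \<partial>kernel p a x)"
      by (subst nn_integral_cmult)
        (simp_all add: measurable_kernel[OF Suc.prems]
          measurable_compose[OF measurable_threshold_action funpow_step_op_measurable[OF m\<phi>]])
    also have "\<dots> \<le> ennreal (\<gamma> * (\<gamma> ^ t * K) * w x)"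
      using Suc K \<gamma> by (intro drift_mult) auto
    finally show ?case by (simp add: ac_simps)
  qed (use \<phi> in simp)
  have s: "(\<lambda>t. \<gamma> ^ t * (K * w x)) sums (1 / (1 - \<gamma>) * (K * w x))"
    using \<gamma> by (intro sums_mult2 geometric_sums) auto
  have "total_value z \<phi> (x, a) \<le> (\<Sum>t. ennreal (\<gamma> ^ t * (K * w x)))"
    unfolding total_value_def using b[OF x] by (intro suminf_le summableI) (simp add: mult.assoc)
  also have "\<dots> = ennreal (1 / (1 - \<gamma>) * (K * w x))"
    using s K \<gamma> w_ge_1[OF x] by (subst suminf_ennreal2) (auto simp: sums_iff)
  finally show ?thesis by simp
qed

lemma nn_integral_trajectory_total:
  assumes x: "x \<in> states p" and \<phi>: "\<phi> \<in> borel_measurable (step_space p)"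
  shows "(\<integral>\<^sup>+\<omega>. (\<Sum>t. ennreal (disc p ^ t) * \<phi> (\<omega> t)) \<partial>trajectory p (first_then a (threshold (ereal z))) x) =
    total_value z \<phi> (x, a)"
proof -
  have m: "(\<lambda>\<omega>. \<phi> (\<omega> t)) \<in> borel_measurable (trajectory p (first_then a (threshold (ereal z))) x)" for t
    unfolding measurable_cong_sets[OF sets_trajectory[OF x] refl]
    using measurable_compose[OF measurable_component_singleton[of t UNIV "\<lambda>_. step_space p"] \<phi>] by simp
  show ?thesis
    using m by (subst nn_integral_suminf)
      (auto simp: total_value_def nn_integral_cmult nn_integral_trajectory[OF x \<phi>])
qed

text \<open>The coercion \<open>ennreal\<close> sends negative reals to 0, so the two totals belong
  to the positive and the negative part of \<open>h\<close>.\<close>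

definition action_value :: "(real \<times> bool \<Rightarrow> real) \<Rightarrow> real \<Rightarrow> real \<times> bool \<Rightarrow> real" where
  "action_value h z q =
     enn2real (total_value z (\<lambda>q. ennreal (h q)) q) - enn2real (total_value z (\<lambda>q. ennreal (- h q)) q)"

text \<open>\<open>q z (x, a)\<close> stands for the value of \<open>\<langle>a, z\<rangle>\<close> from \<open>x\<close> under the payoff \<open>h\<close>.\<close>

definition is_action_value :: "(real \<times> bool \<Rightarrow> real) \<Rightarrow> (real \<Rightarrow> real \<times> bool \<Rightarrow> real) \<Rightarrow> bool" where
  "is_action_value h q \<longleftrightarrow>
     (\<exists>K. \<forall>z. w_bounded K (\<lambda>y. q z (y, z < y)))  \<and>
     (\<forall>z. \<forall>x\<in>states p. \<forall>a. q z (x, a) = h (x, a) + disc p * (\<integral>y. q z (y, z < y) \<partial>kernel p a x))"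

text \<open>Discount factor 0 is covered too: a non-integrable integrand has Bochner integral 0,
  which is also what \<open>enn2real\<close> makes of infinity.\<close>

lemma disc_integral_enn2real:
  assumes x: "x \<in> states p" and f: "f \<in> borel_measurable (state_space p)" and K: "0 \<le> K"
    and b: "\<And>y. y \<in> states p \<Longrightarrow> f y \<le> ennreal (K * w y)"
  shows "enn2real (ennreal (disc p) * (\<integral>\<^sup>+y. f y \<partial>kernel p a x)) = disc p * (\<integral>y. enn2real (f y) \<partial>kernel p a x)"
    "ennreal (disc p) * (\<integral>\<^sup>+y. f y \<partial>kernel p a x) < \<infinity>"
proof -
  show "ennreal (disc p) * (\<integral>\<^sup>+y. f y \<partial>kernel p a x) < \<infinity>"
    using drift_mult[OF x K b, of a] by (simp add: le_less_trans)
  have "f y = ennreal (enn2real (f y))" if "y \<in> states p" for y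
    using le_less_trans[OF b[OF that] ennreal_less_top] by simp
  then have "(\<integral>\<^sup>+y. f y \<partial>kernel p a x) = (\<integral>\<^sup>+y. ennreal (enn2real (f y)) \<partial>kernel p a x)"
    by (intro nn_integral_cong) (simp add: space_kernel[OF x])
  moreover have "(\<integral>y. enn2real (f y) \<partial>kernel p a x) = enn2real (\<integral>\<^sup>+y. ennreal (enn2real (f y)) \<partial>kernel p a x)"
    using f by (intro integral_eq_nn_integral) (auto simp: measurable_kernel[OF x])
  ultimately show "enn2real (ennreal (disc p) * (\<integral>\<^sup>+y. f y \<partial>kernel p a x)) = disc p * (\<integral>y. enn2real (f y) \<partial>kernel p a x)"
    using disc by (simp add: enn2real_mult)
qed

text \<open>The recursion holds for the positive and the negative part separately. Both totals are
  finite by the geometric bound, so the two equations may be subtracted.\<close>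

lemma is_action_value_action_value:
  assumes h: "h \<in> borel_measurable (step_space p)"
    and K: "0 \<le> K" and b: "\<And>x a. x \<in> states p \<Longrightarrow> \<bar>h (x, a)\<bar> \<le> K * w x"
  shows "is_action_value h (action_value h)"
proof -
  define P where "P z = total_value z (\<lambda>q. ennreal (h q))" for z
  define N where "N z = total_value z (\<lambda>q. ennreal (- h q))" for z
  let ?K = "K / (1 - \<gamma>)"
  have K': "0 \<le> ?K" using K \<gamma> by simp
  have b': "ennreal (h (x, a)) \<le> ennreal (K * w x)" "ennreal (- h (x, a)) \<le> ennreal (K * w x)"
    if "x \<in> states p" for x a
    using b[OF that, of a] by (auto intro!: ennreal_leI)
  have le: "P z (x, a) \<le> ennreal (?K * w x)" "N z (x, a) \<le> ennreal (?K * w x)" if "x \<in> states p" for x a z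
    unfolding P_def N_def using that b' h by (intro total_value_le K; simp)+
  have lt: "P z (x, a) < \<infinity>" "N z (x, a) < \<infinity>" if "x \<in> states p" for x a z
    using le[OF that, of z a] by (auto simp: le_less_trans)
  have m: "P z \<in> borel_measurable (step_space p)" "N z \<in> borel_measurable (step_space p)" for z
    unfolding P_def N_def using h by (auto intro!: total_value_measurable)
  have m': "(\<lambda>y. P z (y, z < y)) \<in> borel_measurable (state_space p)"
      "(\<lambda>y. N z (y, z < y)) \<in> borel_measurable (state_space p)" for z
    by (rule measurable_compose[OF measurable_threshold_action] m)+
  have le': "enn2real (P z (x, a)) \<le> ?K * w x" "enn2real (N z (x, a)) \<le> ?K * w x" if "x \<in> states p" for x a z
    using le[OF that, of z a] mult_nonneg_nonneg[OF K', of "w x"] w_ge_1[OF that]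
    by (auto intro!: enn2real_leI)
  have av: "action_value h z q = enn2real (P z q) - enn2real (N z q)" for z q
    by (simp add: action_value_def P_def N_def)
  have wb: "w_bounded ?K (\<lambda>y. enn2real (P z (y, z < y)))" "w_bounded ?K (\<lambda>y. enn2real (N z (y, z < y)))" for z
    using K' m'[of z] le' by (auto simp: w_bounded_def)
  have "w_bounded ?K (\<lambda>y. action_value h z (y, z < y))" for z
  proof -
    have "\<bar>enn2real (P z (y, z < y)) - enn2real (N z (y, z < y))\<bar> \<le> ?K * w y" if "y \<in> states p" for y
      using le'[OF that, of z "z < y"] enn2real_nonneg[of "P z (y, z < y)"] enn2real_nonneg[of "N z (y, z < y)"]
      by linarith
    then show ?thesis
      using K' m'[of z] unfolding w_bounded_def av by auto
  qed
  moreover have "action_value h z (x, a) = h (x, a) + disc p * (\<integral>y. action_value h z (y, z < y) \<partial>kernel p a x)"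
    if x: "x \<in> states p" for x a z
  proof -
    have "P z (x, a) = ennreal (h (x, a)) + ennreal (disc p) * (\<integral>\<^sup>+y. P z (y, z < y) \<partial>kernel p a x)"
      unfolding P_def by (rule total_value_rec[OF _ x]) (use h in simp)
    then have 1: "enn2real (P z (x, a)) = enn2real (ennreal (h (x, a))) + disc p * (\<integral>y. enn2real (P z (y, z < y)) \<partial>kernel p a x)"
      using disc_integral_enn2real[OF x m'(1) K' le(1)] by (simp add: enn2real_plus)
    have "N z (x, a) = ennreal (- h (x, a)) + ennreal (disc p) * (\<integral>\<^sup>+y. N z (y, z < y) \<partial>kernel p a x)"
      unfolding N_def by (rule total_value_rec[OF _ x]) (use h in simp)
    then have 2: "enn2real (N z (x, a)) = enn2real (ennreal (- h (x, a))) + disc p * (\<integral>y. enn2real (N z (y, z < y)) \<partial>kernel p a x)"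
      using disc_integral_enn2real[OF x m'(2) K' le(2)] by (simp add: enn2real_plus)
    have 3: "enn2real (ennreal (h (x, a))) - enn2real (ennreal (- h (x, a))) = h (x, a)"
      by (cases "0 \<le> h (x, a)") (auto simp: ennreal_neg)
    have "disc p * (\<integral>y. action_value h z (y, z < y) \<partial>kernel p a x) =
       disc p * (\<integral>y. enn2real (P z (y, z < y)) \<partial>kernel p a x) - disc p * (\<integral>y. enn2real (N z (y, z < y)) \<partial>kernel p a x)"
    proof (cases "disc p = 0")
      case False
      show ?thesis
        unfolding av using wb[of z, THEN w_bounded_integrable, OF False x]
        by (simp add: right_diff_distrib)
    qed simp
    then show ?thesis
      unfolding av[of z "(x, a)"] 1 2 using 3 by simp
  qed
  ultimately show ?thesis unfolding is_action_value_def by blast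
qed

text \<open>The discounted sums of the positive and negative parts have finite expectations, hence
  are finite almost surely. On such paths the real series is their difference, which can be
  integrated term by term.\<close>

lemma expectation_discounted_sum:
  assumes x: "x \<in> states p" and h: "h \<in> borel_measurable (step_space p)"
    and K: "0 \<le> K" and b: "\<And>x a. x \<in> states p \<Longrightarrow> \<bar>h (x, a)\<bar> \<le> K * w x"
  shows "(\<integral>\<omega>. (\<Sum>t. disc p ^ t * h (\<omega> t)) \<partial>trajectory p (first_then a (threshold (ereal z))) x) =
    action_value h z (x, a)"
proof -
  define \<mu> where "\<mu> = trajectory p (first_then a (threshold (ereal z))) x"
  define A where "A f \<omega> = (\<Sum>t. ennreal (disc p ^ t) * ennreal (f (\<omega> t)))" for f :: "real \<times> bool \<Rightarrow> real" and \<omega>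
  have A_int: "(\<integral>\<^sup>+\<omega>. A f \<omega> \<partial>\<mu>) = total_value z (\<lambda>q. ennreal (f q)) (x, a)"
    and A_meas: "A f \<in> borel_measurable \<mu>"
    if "f \<in> borel_measurable (step_space p)" for f
  proof -
    show "(\<integral>\<^sup>+\<omega>. A f \<omega> \<partial>\<mu>) = total_value z (\<lambda>q. ennreal (f q)) (x, a)"
      unfolding A_def \<mu>_def by (rule nn_integral_trajectory_total[OF x]) (use that in simp)
    have "(\<lambda>\<omega>. f (\<omega> t)) \<in> borel_measurable \<mu>" for t
      unfolding \<mu>_def measurable_cong_sets[OF sets_trajectory[OF x] refl]
      using measurable_compose[OF measurable_component_singleton[of t UNIV "\<lambda>_. step_space p"] that] by simp
    then show "A f \<in> borel_measurable \<mu>" unfolding A_def[abs_def] by measurable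
  qed
  have real: "(\<integral>\<omega>. enn2real (A f \<omega>) \<partial>\<mu>) = enn2real (total_value z (\<lambda>q. ennreal (f q)) (x, a))
      \<and> integrable \<mu> (\<lambda>\<omega>. enn2real (A f \<omega>)) \<and> (AE \<omega> in \<mu>. A f \<omega> < \<infinity>)"
    if f: "f \<in> borel_measurable (step_space p)" and fb: "\<And>x a. x \<in> states p \<Longrightarrow> \<bar>f (x, a)\<bar> \<le> K * w x" for f
  proof -
    have "total_value z (\<lambda>q. ennreal (f q)) (x, a) \<le> ennreal (K / (1 - \<gamma>) * w x)"
      using fb f by (intro total_value_le K x ennreal_leI) (auto intro: order_trans[OF abs_ge_self])
    then have fin: "(\<integral>\<^sup>+\<omega>. A f \<omega> \<partial>\<mu>) < \<infinity>"
      unfolding A_int[OF f] by (auto intro: le_less_trans)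
    then have AE: "AE \<omega> in \<mu>. A f \<omega> < \<infinity>"
      using nn_integral_noteq_infinite[OF A_meas[OF f]] by (auto simp: less_top)
    then have eq: "(\<integral>\<^sup>+\<omega>. ennreal (enn2real (A f \<omega>)) \<partial>\<mu>) = (\<integral>\<^sup>+\<omega>. A f \<omega> \<partial>\<mu>)"
      by (intro nn_integral_cong_AE) auto
    have "(\<integral>\<omega>. enn2real (A f \<omega>) \<partial>\<mu>) = enn2real (\<integral>\<^sup>+\<omega>. ennreal (enn2real (A f \<omega>)) \<partial>\<mu>)"
      using A_meas[OF f] by (intro integral_eq_nn_integral) auto
    moreover have "integrable \<mu> (\<lambda>\<omega>. enn2real (A f \<omega>))"
      using A_meas[OF f] fin eq by (intro integrableI_bounded) auto
    ultimately show ?thesis using AE eq A_int[OF f] by simp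
  qed
  have hm: "(\<lambda>q. - h q) \<in> borel_measurable (step_space p)" using h by simp
  note r1 = real[OF h b] and r2 = real[OF hm, simplified, OF b]
  have "(\<Sum>t. disc p ^ t * h (\<omega> t)) = enn2real (A h \<omega>) - enn2real (A (\<lambda>q. - h q) \<omega>)"
    if "A h \<omega> < \<infinity>" "A (\<lambda>q. - h q) \<omega> < \<infinity>" for \<omega>
  proof -
    have S: "summable (\<lambda>t. disc p ^ t * max 0 (f (\<omega> t)))"
      "A f \<omega> = ennreal (\<Sum>t. disc p ^ t * max 0 (f (\<omega> t)))" if "A f \<omega> < \<infinity>" for f
    proof -
      have e: "ennreal (disc p ^ t) * ennreal (f (\<omega> t)) = ennreal (disc p ^ t * max 0 (f (\<omega> t)))" for t
        using disc by (simp add: ennreal_mult' max_def ennreal_neg)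
      show s: "summable (\<lambda>t. disc p ^ t * max 0 (f (\<omega> t)))"
        using that disc by (intro summable_suminf_not_top) (auto simp: A_def e)
      show "A f \<omega> = ennreal (\<Sum>t. disc p ^ t * max 0 (f (\<omega> t)))"
        unfolding A_def e using disc by (intro suminf_ennreal2 s) auto
    qed
    have nn: "0 \<le> (\<Sum>t. disc p ^ t * max 0 (f (\<omega> t)))" if "A f \<omega> < \<infinity>" for f
      using disc by (intro suminf_nonneg S(1)[OF that]) auto
    have "(\<Sum>t. disc p ^ t * h (\<omega> t)) = (\<Sum>t. disc p ^ t * max 0 (h (\<omega> t)) - disc p ^ t * max 0 (- h (\<omega> t)))"
      by (intro suminf_cong) (auto simp: max_def)
    also have "\<dots> = (\<Sum>t. disc p ^ t * max 0 (h (\<omega> t))) - (\<Sum>t. disc p ^ t * max 0 (- h (\<omega> t)))"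
      using S(1)[OF that(1)] S(1)[OF that(2)] by (rule suminf_diff[symmetric])
    finally show ?thesis
      unfolding S(2)[OF that(1)] S(2)[OF that(2)]
      using nn[OF that(1)] nn[OF that(2)] by simp
  qed
  then have "AE \<omega> in \<mu>. (\<Sum>t. disc p ^ t * h (\<omega> t)) = enn2real (A h \<omega>) - enn2real (A (\<lambda>q. - h q) \<omega>)"
    using r1 r2 by auto
  moreover have "(\<lambda>\<omega>. \<Sum>t. disc p ^ t * h (\<omega> t)) \<in> borel_measurable \<mu>"
  proof -
    have "(\<lambda>\<omega>. h (\<omega> t)) \<in> borel_measurable \<mu>" for t
      unfolding \<mu>_def measurable_cong_sets[OF sets_trajectory[OF x] refl]
      using measurable_compose[OF measurable_component_singleton[of t UNIV "\<lambda>_. step_space p"] h] by simp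
    then show ?thesis by measurable
  qed
  ultimately have "(\<integral>\<omega>. (\<Sum>t. disc p ^ t * h (\<omega> t)) \<partial>\<mu>) = (\<integral>\<omega>. enn2real (A h \<omega>) - enn2real (A (\<lambda>q. - h q) \<omega>) \<partial>\<mu>)"
    using A_meas[OF h] A_meas[OF hm] by (intro integral_cong_AE) auto
  also have "\<dots> = action_value h z (x, a)"
    unfolding action_value_def using r1 r2 by (subst Bochner_Integration.integral_diff) auto
  finally show ?thesis by (simp add: \<mu>_def)
qed

end

section \<open>Dependence of action values on the threshold\<close>

context drift_model
begin

text \<open>With \<open>c\<close> the index at a fixed threshold, reward minus priced resource
  becomes a single payoff, to which the continuity results apply.\<close>

lemma is_action_value_diff:
  assumes q: "is_action_value h q" and q': "is_action_value h' q'"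
  shows "is_action_value (\<lambda>i. h i - c * h' i) (\<lambda>z i. q z i - c * q' z i)"
proof -
  obtain K K' where K: "w_bounded K (\<lambda>y. q z (y, z < y))" and K': "w_bounded K' (\<lambda>y. q' z (y, z < y))" for z
    using q q' unfolding is_action_value_def by blast
  have "w_bounded (K + \<bar>c\<bar> * K') (\<lambda>y. q z (y, z < y) - c * q' z (y, z < y))" for z
    unfolding w_bounded_def
  proof (intro conjI ballI)
    show "0 \<le> K + \<bar>c\<bar> * K'" using K K' by (simp add: w_bounded_def)
    show "(\<lambda>y. q z (y, z < y) - c * q' z (y, z < y)) \<in> borel_measurable (state_space p)"
      using K K' unfolding w_bounded_def by (intro borel_measurable_diff borel_measurable_times) auto
    fix y assume y: "y \<in> states p"
    have "\<bar>q z (y, z < y)\<bar> \<le> K * w y" "\<bar>q' z (y, z < y)\<bar> \<le> K' * w y"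
      using K K' y by (auto simp: w_bounded_def)
    moreover from this(2) have "\<bar>c * q' z (y, z < y)\<bar> \<le> \<bar>c\<bar> * (K' * w y)"
      by (simp add: abs_mult mult_left_mono)
    ultimately show "\<bar>q z (y, z < y) - c * q' z (y, z < y)\<bar> \<le> (K + \<bar>c\<bar> * K') * w y"
      by (simp add: algebra_simps)
  qed
  moreover have "q z (x, a) - c * q' z (x, a) = h (x, a) - c * h' (x, a) +
      disc p * (\<integral>y. q z (y, z < y) - c * q' z (y, z < y) \<partial>kernel p a x)" if x: "x \<in> states p" for z x a
  proof -
    have *: "disc p * (\<integral>y. q z (y, z < y) - c * q' z (y, z < y) \<partial>kernel p a x) =
        disc p * (\<integral>y. q z (y, z < y) \<partial>kernel p a x) - c * (disc p * (\<integral>y. q' z (y, z < y) \<partial>kernel p a x))"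
    proof (cases "disc p = 0")
      case False
      then show ?thesis
        using w_bounded_integrable[OF K False x] w_bounded_integrable[OF K' False x]
        by (simp add: right_diff_distrib)
    qed simp
    have "q z (x, a) = h (x, a) + disc p * (\<integral>y. q z (y, z < y) \<partial>kernel p a x)"
      "q' z (x, a) = h' (x, a) + disc p * (\<integral>y. q' z (y, z < y) \<partial>kernel p a x)"
      using q q' x unfolding is_action_value_def by blast+
    then show ?thesis unfolding * by (simp add: algebra_simps)
  qed
  ultimately show ?thesis unfolding is_action_value_def by blast
qed

lemma is_action_value_increment_bounded:
  assumes q: "is_action_value h q"
  shows "\<exists>K. \<forall>z z'. w_bounded K (\<lambda>y. q z' (y, z' < y) - q z (y, z < y))"
proof -
  obtain K where K: "w_bounded K (\<lambda>y. q z (y, z < y))" for z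
    using q unfolding is_action_value_def by blast
  have "w_bounded (2 * K) (\<lambda>y. q z' (y, z' < y) - q z (y, z < y))" for z z'
    unfolding w_bounded_def
  proof (intro conjI ballI)
    show "0 \<le> 2 * K" using K by (simp add: w_bounded_def)
    show "(\<lambda>y. q z' (y, z' < y) - q z (y, z < y)) \<in> borel_measurable (state_space p)"
      using K unfolding w_bounded_def by (intro borel_measurable_diff) auto
    fix y assume y: "y \<in> states p"
    have "\<bar>q z (y, z < y)\<bar> \<le> K * w y" for z
      using K y by (auto simp: w_bounded_def)
    from this[of z] this[of z'] show "\<bar>q z' (y, z' < y) - q z (y, z < y)\<bar> \<le> 2 * K * w y"
      by linarith
  qed
  then show ?thesis by blast
qed

text \<open>With equal first actions the immediate payoffs cancel and only the discounted
  discrepancy from the next state remains. The contraction arguments below start from this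
  identity.\<close>

lemma is_action_value_increment:
  assumes q: "is_action_value h q" and x: "x \<in> states p"
  shows "q z' (x, a) - q z (x, a) = disc p * (\<integral>y. q z' (y, z' < y) - q z (y, z < y) \<partial>kernel p a x)"
proof -
  obtain K where K: "w_bounded K (\<lambda>y. q z (y, z < y))" for z
    using q unfolding is_action_value_def by blast
  have *: "disc p * (\<integral>y. q z' (y, z' < y) - q z (y, z < y) \<partial>kernel p a x) =
      disc p * (\<integral>y. q z' (y, z' < y) \<partial>kernel p a x) - disc p * (\<integral>y. q z (y, z < y) \<partial>kernel p a x)"
  proof (cases "disc p = 0")
    case False
    then show ?thesis
      using w_bounded_integrable[OF K False x]
      by (simp add: right_diff_distrib)
  qed simp
  have "q z (x, a) = h (x, a) + disc p * (\<integral>y. q z (y, z < y) \<partial>kernel p a x)" for z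
    using q x unfolding is_action_value_def by blast
  from this[of z] this[of z'] show ?thesis unfolding * by simp
qed

lemma disc_integral_norm_bound:
  assumes f: "w_bounded K f" and x: "x \<in> states p"
  shows "ennreal \<bar>disc p * (\<integral>y. f y \<partial>kernel p a x)\<bar> \<le>
    ennreal (disc p) * (\<integral>\<^sup>+y. ennreal \<bar>f y\<bar> \<partial>kernel p a x)"
proof (cases "disc p = 0")
  case False
  have "ennreal \<bar>\<integral>y. f y \<partial>kernel p a x\<bar> \<le> (\<integral>\<^sup>+y. ennreal \<bar>f y\<bar> \<partial>kernel p a x)"
    using integral_norm_bound_ennreal[OF w_bounded_integrable[OF f False x], of a] by simp
  then show ?thesis
    using disc by (simp add: abs_mult ennreal_mult' mult_left_mono)
qed simp

text \<open>Starting with the action of the lower threshold can only help when the higher one is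
  followed afterwards. Hence the gain \<open>D\<close> from raising the threshold is at most its
  discounted mean at the next state, and the contraction removes its positive part.\<close>

lemma action_value_antimono:
  assumes q: "is_action_value h q"
    and le: "\<And>y z. y \<in> states p \<Longrightarrow> q z (y, False) \<le> q z (y, True)"
    and z: "z \<le> z'" and x: "x \<in> states p"
  shows "q z' (x, z' < x) \<le> q z (x, z < x)"
proof -
  define D where "D y = q z' (y, z' < y) - q z (y, z < y)" for y
  obtain K where K: "w_bounded K D"
    using is_action_value_increment_bounded[OF q] unfolding D_def[abs_def] by blast
  have inc: "q z' (x, a) - q z (x, a) = disc p * (\<integral>y. D y \<partial>kernel p a x)" if "x \<in> states p" for x a
    unfolding D_def by (rule is_action_value_increment[OF q that])
  \<comment> \<open>As a member of \<open>ennreal\<close>, \<open>D x\<close> is its own positive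
    part, so this says \<open>D x \<le> 0\<close>.\<close>
  have "ennreal (D x) = 0"
  proof (rule contraction_zero[OF _ _ _ x])
    show "0 \<le> K" using K by (simp add: w_bounded_def)
    show "ennreal (D y) \<le> ennreal (K * w y)" if "y \<in> states p" for y
      using K that by (intro ennreal_leI) (fastforce simp: w_bounded_def)
    show "\<exists>a. ennreal (D y) \<le> ennreal (disc p) * (\<integral>\<^sup>+u. ennreal (D u) \<partial>kernel p a y)"
      if y: "y \<in> states p" for y
    proof
      let ?a = "z < y"
      \<comment> \<open>Since \<open>z \<le> z'\<close>, the two first actions differ only if
        \<open>z\<close> prescribes active and \<open>z'\<close> passive.\<close>
      have "q z' (y, z' < y) \<le> q z' (y, z < y)"
        using le[OF y, of z'] z by (cases "z < y"; cases "z' < y") auto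
      then have "D y \<le> disc p * (\<integral>u. D u \<partial>kernel p ?a y)"
        using inc[OF y, of ?a] by (simp add: D_def)
      also have "\<dots> \<le> disc p * (\<integral>u. max 0 (D u) \<partial>kernel p ?a y)"
      proof (cases "disc p = 0")
        case False
        have i: "integrable (kernel p ?a y) D" by (rule w_bounded_integrable[OF K False y])
        show ?thesis
          using disc by (intro mult_left_mono integral_mono i integrable_max) auto
      qed simp
      finally have "ennreal (D y) \<le> ennreal \<bar>disc p * (\<integral>u. max 0 (D u) \<partial>kernel p ?a y)\<bar>"
        by (intro ennreal_leI) auto
      also have "\<dots> \<le> ennreal (disc p) * (\<integral>\<^sup>+u. ennreal \<bar>max 0 (D u)\<bar> \<partial>kernel p ?a y)"
      proof (rule disc_integral_norm_bound[OF _ y])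
        have "\<bar>max 0 (D u)\<bar> \<le> \<bar>D u\<bar>" for u by auto
        then have "\<bar>max 0 (D u)\<bar> \<le> K * w u" if "u \<in> states p" for u
          using K that unfolding w_bounded_def by (meson order_trans)
        then show "w_bounded K (\<lambda>u. max 0 (D u))"
          using K unfolding w_bounded_def by (intro conjI ballI borel_measurable_max) auto
      qed
      also have "(\<lambda>u. ennreal \<bar>max 0 (D u)\<bar>) = (\<lambda>u. ennreal (D u))"
      proof
        show "ennreal \<bar>max 0 (D u)\<bar> = ennreal (D u)" for u
          by (cases "0 \<le> D u") (simp_all add: ennreal_neg)
      qed
      finally show "ennreal (D y) \<le> ennreal (disc p) * (\<integral>\<^sup>+u. ennreal (D u) \<partial>kernel p ?a y)" .
    qed
  qed
  then show ?thesis by (simp add: D_def ennreal_eq_0_iff)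
qed

text \<open>The limit superior of the discrepancies inherits the contraction inequality through
  the reverse Fatou lemma, so it vanishes.\<close>

lemma action_value_tendsto:
  assumes q: "is_action_value h q"
    and agree: "\<And>y. y \<in> states p \<Longrightarrow> \<exists>a. q z (y, z < y) = q z (y, a) \<and> (\<forall>\<^sub>F n in sequentially. (Z n < y) = a)"
    and x: "x \<in> states p"
  shows "(\<lambda>n. q (Z n) (x, Z n < x)) \<longlonglongrightarrow> q z (x, z < x)"
proof -
  define D where "D n y = q (Z n) (y, Z n < y) - q z (y, z < y)" for n y
  obtain K where K: "w_bounded K (D n)" for n
    using is_action_value_increment_bounded[OF q] unfolding D_def[abs_def] by blast
  have inc: "q (Z n) (x, a) - q z (x, a) = disc p * (\<integral>y. D n y \<partial>kernel p a x)" if "x \<in> states p" for n x a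
    unfolding D_def by (rule is_action_value_increment[OF q that])
  have bound: "ennreal \<bar>D n y\<bar> \<le> ennreal (K * w y)" if "y \<in> states p" for n y
    using K that by (auto simp: w_bounded_def intro!: ennreal_leI)
  have Dm: "(\<lambda>y. ennreal \<bar>D n y\<bar>) \<in> borel_measurable (state_space p)" for n
  proof -
    have [measurable]: "D n \<in> borel_measurable (state_space p)"
      using K[of n] by (simp add: w_bounded_def)
    show ?thesis by measurable
  qed
  have wm: "(\<lambda>y. ennreal (K * w y)) \<in> borel_measurable (state_space p)"
    using w_measurable by simp
  define L where "L y = limsup (\<lambda>n. ennreal \<bar>D n y\<bar>)" for y
  have "L x = 0"
  proof (rule contraction_zero[OF _ _ _ x])
    show "0 \<le> K" using K by (simp add: w_bounded_def)
    show "L y \<le> ennreal (K * w y)" if "y \<in> states p" for y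
      unfolding L_def using bound[OF that] by (intro Limsup_bounded) auto
    show "\<exists>a. L y \<le> ennreal (disc p) * (\<integral>\<^sup>+u. L u \<partial>kernel p a y)" if y: "y \<in> states p" for y
    proof -
      obtain a where a: "q z (y, z < y) = q z (y, a)" "\<forall>\<^sub>F n in sequentially. (Z n < y) = a"
        using agree[OF y] by auto
      have "\<forall>\<^sub>F n in sequentially. ennreal \<bar>D n y\<bar> \<le> ennreal (disc p) * (\<integral>\<^sup>+u. ennreal \<bar>D n u\<bar> \<partial>kernel p a y)"
        using a(2)
      proof eventually_elim
        case (elim n)
        \<comment> \<open>Once \<open>Z n\<close> prescribes \<open>a\<close> at \<open>y\<close>,
          both policies may be taken to start with \<open>a\<close>, so the first step contributes
          no discrepancy.\<close>
        then have "D n y = disc p * (\<integral>u. D n u \<partial>kernel p a y)"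
          using inc[OF y, of n a] a(1) by (simp add: D_def)
        then show ?case using disc_integral_norm_bound[OF K[of n] y, of a] by simp
      qed
      then have "L y \<le> limsup (\<lambda>n. ennreal (disc p) * (\<integral>\<^sup>+u. ennreal \<bar>D n u\<bar> \<partial>kernel p a y))"
        unfolding L_def by (rule Limsup_mono)
      also have "\<dots> = ennreal (disc p) * limsup (\<lambda>n. \<integral>\<^sup>+u. ennreal \<bar>D n u\<bar> \<partial>kernel p a y)"
        by (rule Limsup_compose_continuous_mono)
          (auto intro!: ennreal_continuous_on_cmult continuous_on_id monoI mult_left_mono)
      also have "\<dots> \<le> ennreal (disc p) * (\<integral>\<^sup>+u. L u \<partial>kernel p a y)"
      proof (cases "disc p = 0")
        case False
        \<comment> \<open>The integrable majorant required by the reverse Fatou lemma; its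
          finiteness follows from the drift bound because the discount factor is nonzero
          here.\<close>
        have fin: "(\<integral>\<^sup>+u. ennreal (K * w u) \<partial>kernel p a y) < \<infinity>"
        proof -
          have "ennreal (disc p) * (\<integral>\<^sup>+u. ennreal (K * w u) \<partial>kernel p a y) \<le> ennreal (\<gamma> * K * w y)"
            using \<open>0 \<le> K\<close> by (intro drift_mult y) auto
          also have "\<dots> < \<infinity>" by simp
          finally show ?thesis
            using False disc by (auto simp: ennreal_mult_less_top)
        qed
        show ?thesis
          unfolding L_def
          using Dm wm bound fin
          by (intro mult_left_mono nn_integral_limsup[where w="\<lambda>u. ennreal (K * w u)"] AE_I2)
            (auto simp: measurable_kernel[OF y] space_kernel[OF y])
      qed simp
      finally show ?thesis by auto
    qed
  qed
  then have "(\<lambda>n. ennreal \<bar>D n x\<bar>) \<longlonglongrightarrow> 0"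
    unfolding L_def by (rule tendsto_0_if_Limsup_eq_0_ennreal)
  then have "(\<lambda>n. \<bar>D n x\<bar>) \<longlonglongrightarrow> 0"
    using tendsto_ennrealD[of "\<lambda>n. \<bar>D n x\<bar>" 0 sequentially] by simp
  then have "(\<lambda>n. D n x) \<longlonglongrightarrow> 0" by (rule tendsto_rabs_zero_cancel)
  then show ?thesis unfolding D_def by (rule LIM_zero_cancel)
qed

text \<open>Thresholds approaching \<open>z\<close> from above eventually activate any given state
  above \<open>z\<close> and never one at or below it. This is the rule of \<open>z\<close> itself,
  because the threshold inequality is strict.\<close>

lemma action_value_right_continuous:
  assumes q: "is_action_value h q" and x: "x \<in> states p"
  shows "((\<lambda>z. q z (x, z < x)) \<longlongrightarrow> q z (x, z < x)) (at_right z)"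
proof (rule tendsto_at_right_sequentially[of z "z + 1"])
  fix Z :: "nat \<Rightarrow> real"
  assume Z: "\<And>n. z < Z n" "Z \<longlonglongrightarrow> z"
  show "(\<lambda>n. q (Z n) (x, Z n < x)) \<longlonglongrightarrow> q z (x, z < x)"
  proof (rule action_value_tendsto[OF q _ x])
    fix y
    have "\<forall>\<^sub>F n in sequentially. (Z n < y) = (z < y)"
    proof (cases "z < y")
      case True
      then show ?thesis using order_tendstoD(2)[OF Z(2) True] by (auto elim: eventually_mono)
    next
      case False
      then have "\<not> Z n < y" for n using Z(1)[of n] by auto
      with False show ?thesis by simp
    qed
    then show "\<exists>a. q z (y, z < y) = q z (y, a) \<and> (\<forall>\<^sub>F n in sequentially. (Z n < y) = a)"
      by blast
  qed
qed simp

text \<open>From below the limiting rule is \<open>z \<le> y\<close> instead of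
  \<open>z < y\<close>; the two differ only in the state \<open>y = z\<close>, where the first
  action is indifferent by assumption.\<close>

lemma action_value_left_continuous:
  assumes q: "is_action_value h q" and x: "x \<in> states p"
    and indifferent: "z \<in> states p \<Longrightarrow> q z (z, False) = q z (z, True)"
  shows "((\<lambda>z. q z (x, z < x)) \<longlongrightarrow> q z (x, z < x)) (at_left z)"
proof (rule tendsto_at_left_sequentially[of "z - 1" z])
  fix Z :: "nat \<Rightarrow> real"
  assume Z: "\<And>n. Z n < z" "Z \<longlonglongrightarrow> z"
  show "(\<lambda>n. q (Z n) (x, Z n < x)) \<longlonglongrightarrow> q z (x, z < x)"
  proof (rule action_value_tendsto[OF q _ x])
    fix y assume y: "y \<in> states p"
    have "\<forall>\<^sub>F n in sequentially. (Z n < y) = (z \<le> y)"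
    proof (cases "z \<le> y")
      case True
      then have "Z n < y" for n using Z(1)[of n] by auto
      with True show ?thesis by simp
    next
      case False
      then have "y < z" by simp
      then show ?thesis using order_tendstoD(1)[OF Z(2)] by (fastforce elim: eventually_mono)
    qed
    moreover have "q z (y, z < y) = q z (y, z \<le> y)"
      using indifferent y by (cases "y = z") (auto simp: less_le)
    ultimately show "\<exists>a. q z (y, z < y) = q z (y, a) \<and> (\<forall>\<^sub>F n in sequentially. (Z n < y) = a)"
      by blast
  qed
qed simp

end

section \<open>Index and pieces\<close>

context project_model
begin


lemma bounds_order: "lower p < upper p"
  using project by (simp add: restless_project_def)

text \<open>The constant extension of the index is its composition with the nearest-point projection
  onto the state interval, which carries monotonicity and continuity over to the whole line.\<close>

lemma clamp_to_states:
  obtains \<rho> :: "real \<Rightarrow> real" where "\<And>z. \<rho> z \<in> states p" "mono \<rho>" "continuous_on UNIV \<rho>"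
    "\<And>z. mp_index_ext p z = mp_index p (\<rho> z)" "\<And>z. z \<in> states p \<Longrightarrow> \<rho> z = z"
proof -
  define \<rho> where "\<rho> z = (if ereal z < lower p then real_of_ereal (lower p)
      else if upper p < ereal z then real_of_ereal (upper p) else z)" for z
  have "(\<forall>z. \<rho> z \<in> states p) \<and> mono \<rho> \<and> continuous_on UNIV \<rho> \<and> (\<forall>z\<in>states p. \<rho> z = z)"
  proof (cases "lower p")
    case l: (real l)
    show ?thesis
    proof (cases "upper p")
      case (real u)
      have "\<rho> = (\<lambda>z. max l (min u z))" "l < u"
        using bounds_order by (auto simp: \<rho>_def l real fun_eq_iff)
      then show ?thesis
        by (auto simp: states_def l real mono_def intro!: continuous_intros)
    next
      case PInf
      have "\<rho> = (\<lambda>z. max l z)" by (auto simp: \<rho>_def l PInf fun_eq_iff)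
      then show ?thesis
        by (auto simp: states_def l PInf mono_def intro!: continuous_intros)
    qed (use bounds_order in auto)
  next
    case MInf
    show ?thesis
    proof (cases "upper p")
      case (real u)
      have "\<rho> = (\<lambda>z. min u z)" by (auto simp: \<rho>_def MInf real fun_eq_iff)
      then show ?thesis
        by (auto simp: states_def MInf real mono_def intro!: continuous_intros)
    next
      case PInf
      have "\<rho> = (\<lambda>z. z)" by (auto simp: \<rho>_def MInf PInf fun_eq_iff)
      then show ?thesis
        by (auto simp: states_def MInf PInf mono_def intro!: continuous_intros)
    qed (use bounds_order in auto)
  qed (use bounds_order in auto)
  moreover have "mp_index_ext p z = mp_index p (\<rho> z)" for z
    by (simp add: mp_index_ext_def \<rho>_def)
  ultimately show ?thesis using that by blast
qed

lemma measurable_step_space: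
  assumes "\<And>a. continuous_on (states p) (\<lambda>x. h x a)"
  shows "(\<lambda>q. h (fst q) (snd q) :: real) \<in> borel_measurable (step_space p)"
proof -
  have "(\<lambda>x. h x a) \<in> borel_measurable (state_space p)" for a
    unfolding state_space_def by (rule borel_measurable_continuous_on_restrict[OF assms])
  then show ?thesis
    unfolding step_space_def
    by (intro measurable_compose_countable'[where f="\<lambda>a q. h (fst q) a" and g=snd and I=UNIV])
       (auto intro: measurable_compose[OF measurable_fst])
qed

end

text \<open>At most one point is lost: a finite left endpoint, or the singleton itself.\<close>

lemma countable_left_semiclosed_minus_interior:
  assumes "left_semiclosed J \<or> is_singleton J"
  shows "countable (J - interior J)"
  using assms
proof
  assume "left_semiclosed J"
  then obtain a b :: ereal where J: "J = {z. a \<le> ereal z \<and> ereal z < b}"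
    unfolding left_semiclosed_def by blast
  have "open {z. a < ereal z \<and> ereal z < b}"
    by (intro open_Collect_conj open_Collect_less continuous_intros)
  then have "{z. a < ereal z \<and> ereal z < b} \<subseteq> interior J"
    by (intro interior_maximal) (auto simp: J)
  \<comment> \<open>For \<open>a\<close> equal to minus infinity the left side is empty and the
    default value \<open>real_of_ereal a = 0\<close> is harmless.\<close>
  then have "J - interior J \<subseteq> {real_of_ereal a}"
    unfolding J by (auto simp: less_le)
  then show ?thesis by (rule countable_subset) simp
next
  assume "is_singleton J"
  then obtain a where "J = {a}" by (auto simp: is_singleton_def)
  then show ?thesis by (intro countable_finite) simp
qed

text \<open>Disjointness leaves a single term of the sum on the open set
  \<open>interior (S i)\<close>, so \<open>f\<close> agrees with \<open>g i\<close> near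
  \<open>z\<close>.\<close>

lemma differentiable_piecewise:
  fixes f :: "real \<Rightarrow> real"
  assumes f: "\<And>z. f z = (\<Sum>\<^sub>\<infinity>j\<in>N. g j z * indicator (S j) z)"
    and S: "disjoint_family_on S N" and i: "i \<in> N"
    and g: "g i differentiable_on interior (S i)" and z: "z \<in> interior (S i)"
  shows "f differentiable at z"
proof -
  have eq: "f y = g i y" if "y \<in> interior (S i)" for y
  proof -
    have y: "y \<in> S i" using that interior_subset by blast
    have "f y = (\<Sum>\<^sub>\<infinity>j\<in>{i}. g j y * indicator (S j) y)"
      unfolding f
    proof (rule infsum_cong_neutral)
      fix j assume "j \<in> N - {i}"
      then have "y \<notin> S j" using S i y by (auto simp: disjoint_family_on_def)
      then show "g j y * indicator (S j) y = 0" by simp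
    qed (use i in auto)
    then show ?thesis using y by simp
  qed
  obtain f' where "(g i has_derivative f') (at z)"
    using g z by (auto simp: differentiable_on_def differentiable_def at_within_open[OF z open_interior])
  then have "(f has_derivative f') (at z)"
    by (rule has_derivative_transform_within_open[OF _ open_interior z]) (simp add: eq)
  then show ?thesis by (auto simp: differentiable_def)
qed

text \<open>At each threshold at most one term of either decomposition is nonzero. The total
  operator \<open>deriv\<close> carries its usual meaning in \<open>deriv_eq\<close>, since both
  metrics are differentiable at interior points of the pieces.\<close>

theorem proposition5:
  fixes p :: project
    and N :: "real \<Rightarrow> 'i set"
    and S :: "real \<Rightarrow> 'i \<Rightarrow> real set"
    and Fi Gi :: "real \<Rightarrow> 'i \<Rightarrow> real \<Rightarrow> real"
  assumes project: "restless_project p"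
    and PCLI1: "\<And>x (z :: ereal). x \<in> states p \<Longrightarrow> marginal_resource p x (threshold z) > 0"
    and PCLI2: "mono_on (states p) (mp_index p)" "continuous_on (states p) (mp_index p)"
    and countable_pieces: "\<And>x. x \<in> states p \<Longrightarrow> countable (N x)"
    and partition: "\<And>x. x \<in> states p \<Longrightarrow> disjoint_family_on (S x) (N x)"
      "\<And>x. x \<in> states p \<Longrightarrow> (\<Union>i\<in>N x. S x i) = UNIV"
    and pieces: "\<And>x i. x \<in> states p \<Longrightarrow> i \<in> N x \<Longrightarrow>
        left_semiclosed (S x i) \<or> is_singleton (S x i)"
    and F_decomp: "\<And>x (z :: real). x \<in> states p \<Longrightarrow>
        reward_metric p x (threshold z) = (\<Sum>\<^sub>\<infinity>i\<in>N x. Fi x i z * indicator (S x i) z)"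
    and G_decomp: "\<And>x (z :: real). x \<in> states p \<Longrightarrow>
        resource_metric p x (threshold z) = (\<Sum>\<^sub>\<infinity>i\<in>N x. Gi x i z * indicator (S x i) z)"
    and Fi_diff: "\<And>x i. x \<in> states p \<Longrightarrow> i \<in> N x \<Longrightarrow> Fi x i differentiable_on interior (S x i)"
    and Gi_diff: "\<And>x i. x \<in> states p \<Longrightarrow> i \<in> N x \<Longrightarrow> Gi x i differentiable_on interior (S x i)"
    and deriv_eq: "\<And>x i z. x \<in> states p \<Longrightarrow> i \<in> N x \<Longrightarrow> z \<in> interior (S x i) \<Longrightarrow>
        deriv (\<lambda>z :: real. reward_metric p x (threshold z)) z =
          mp_index_ext p z * deriv (\<lambda>z :: real. resource_metric p x (threshold z)) z"
  shows "\<forall>x\<in>states p. \<forall>z\<^sub>1 z\<^sub>2 :: real. z\<^sub>1 < z\<^sub>2 \<longrightarrow>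
    has_LS_integral (mp_index_ext p) (\<lambda>z :: real. resource_metric p x (threshold z)) {z\<^sub>1<..z\<^sub>2}
      (reward_metric p x (threshold z\<^sub>2) - reward_metric p x (threshold z\<^sub>1))"
proof (intro ballI allI impI)
  fix x z\<^sub>1 z\<^sub>2 :: real
  assume x: "x \<in> states p" and z12: "z\<^sub>1 < z\<^sub>2"
  interpret project_model p by unfold_locales (rule project)
  obtain w M \<gamma> where w: "w \<in> borel_measurable (state_space p)" "\<And>x. x \<in> states p \<Longrightarrow> 1 \<le> w x"
    and M: "0 < M" and \<gamma>: "disc p \<le> \<gamma>" "\<gamma> < 1"
    and bound: "\<And>x a. x \<in> states p \<Longrightarrow> max \<bar>reward p x a\<bar> (cost p x a) \<le> M * w x"
    and drift: "\<And>x a. x \<in> states p \<Longrightarrow>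
      ennreal (disc p) * (\<integral>\<^sup>+y. ennreal (w y) \<partial>kernel p a x) \<le> ennreal (\<gamma> * w x)"
    using project unfolding restless_project_def by blast
  have disc0: "0 \<le> disc p" using project by (simp add: restless_project_def)
  interpret drift_model p w \<gamma>
    using w \<gamma> drift disc0 by unfold_locales auto
  define r where "r q = reward p (fst q) (snd q)" for q
  define c where "c q = cost p (fst q) (snd q)" for q
  have r_meas: "r \<in> borel_measurable (step_space p)" and c_meas: "c \<in> borel_measurable (step_space p)"
    unfolding r_def[abs_def] c_def[abs_def]
    using project by (auto intro!: measurable_step_space simp: restless_project_def)
  have r_bound: "\<bar>r (y, a)\<bar> \<le> M * w y" if "y \<in> states p" for y a
    using bound[OF that, of a] by (simp add: r_def)
  \<comment> \<open>The growth condition bounds \<open>cost\<close> only from above; the absolute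
    value is controlled through nonnegativity.\<close>
  have c_bound: "\<bar>c (y, a)\<bar> \<le> M * w y" if "y \<in> states p" for y a
  proof -
    have "0 \<le> cost p y False" "cost p y False < cost p y True"
      using project that by (auto simp: restless_project_def)
    then have "0 \<le> cost p y a" by (cases a) auto
    then show ?thesis using bound[OF that, of a] by (simp add: c_def)
  qed
  let ?R = "action_value r" and ?C = "action_value c"
  have R: "is_action_value r ?R" and C: "is_action_value c ?C"
    using M by (intro is_action_value_action_value[where K=M] r_meas c_meas r_bound c_bound; simp)+
  have reward: "reward_metric p y (first_then a (threshold (ereal z))) = ?R z (y, a)"
    and resource: "resource_metric p y (first_then a (threshold (ereal z))) = ?C z (y, a)"
    if "y \<in> states p" for y a z
    using M expectation_discounted_sum[OF that r_meas _ r_bound] expectation_discounted_sum[OF that c_meas _ c_bound]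
    by (simp_all add: reward_metric_def resource_metric_def r_def[symmetric] c_def[symmetric])
  have F_eq: "reward_metric p y (threshold (ereal z)) = ?R z (y, z < y)"
    and G_eq: "resource_metric p y (threshold (ereal z)) = ?C z (y, z < y)"
    if "y \<in> states p" for y z
    using reward[OF that] resource[OF that] trajectory_threshold[OF that, of "ereal z"]
    by (simp_all add: reward_metric_def resource_metric_def)
  have C_pos: "?C z (y, False) < ?C z (y, True)" if "y \<in> states p" for y z
    using PCLI1[OF that, of "ereal z"] resource[OF that] by (simp add: marginal_resource_def)
  define m where "m = mp_index_ext p"
  obtain \<rho> where \<rho>: "\<And>z. \<rho> z \<in> states p" "mono \<rho>" "continuous_on UNIV \<rho>"
    "\<And>z. m z = mp_index p (\<rho> z)" "\<And>z. z \<in> states p \<Longrightarrow> \<rho> z = z"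
    unfolding m_def by (rule clamp_to_states) blast
  have m_mono: "mono m"
    using \<rho>(1,2) by (auto simp: mono_def \<rho>(4) intro!: mono_onD[OF PCLI2(1)])
  have m_cont: "continuous_on UNIV m"
    unfolding \<rho>(4)[abs_def] using \<rho>(1,3)
    by (intro continuous_on_compose2[OF PCLI2(2)]) auto
  define F where "F z = reward_metric p x (threshold (ereal z))" for z
  \<comment> \<open>The resource metric is nonincreasing in the threshold, so its negative serves as
    integrator, and the increment formula is applied to \<open>- F\<close>.\<close>
  define P where "P z = - resource_metric p x (threshold (ereal z))" for z
  define D where "D = (\<Union>i\<in>N x. S x i - interior (S x i))"
  have D: "countable D"
    unfolding D_def
    by (intro countable_UN countable_pieces[OF x] countable_left_semiclosed_minus_interior pieces[OF x])
  have off_D: "\<exists>i\<in>N x. z \<in> interior (S x i)" if "z \<notin> D" for z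
  proof -
    obtain i where "i \<in> N x" "z \<in> S x i" using partition(2)[OF x] by (metis UNIV_I UN_E)
    then show ?thesis using that by (auto simp: D_def)
  qed
  have P_mono: "mono P"
  proof (rule monoI)
    show "P a \<le> P b" if "a \<le> b" for a b
      unfolding P_def G_eq[OF x]
      using action_value_antimono[OF C less_imp_le[OF C_pos] that x] by simp
  qed
  have P_cont: "continuous (at_right z) P" for z
    unfolding continuous_within P_def G_eq[OF x]
    by (intro tendsto_minus action_value_right_continuous[OF C x])
  have F_cont: "continuous (at_right z) F" for z
    unfolding continuous_within F_def F_eq[OF x]
    by (rule action_value_right_continuous[OF R x])
  have jump: "((\<lambda>y. - F y - m z * P y) \<longlongrightarrow> - F z - m z * P z) (at_left z)" for z
  proof -
    \<comment> \<open>The price \<open>m z\<close> stays fixed while the threshold \<open>y\<close>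
      moves, so this is the value of the \<open>y\<close>-policy for the single payoff
      \<open>r - m z * c\<close>.\<close>
    have "((\<lambda>y. ?R y (x, y < x) - m z * ?C y (x, y < x)) \<longlongrightarrow> ?R z (x, z < x) - m z * ?C z (x, z < x)) (at_left z)"
    proof (rule action_value_left_continuous[OF is_action_value_diff[OF R C] x])
      assume z: "z \<in> states p"
      \<comment> \<open>The quotient defining the index, cleared of its positive denominator, is
        exactly indifference between the two actions at price \<open>m z\<close>.\<close>
      have "m z * (?C z (z, True) - ?C z (z, False)) = ?R z (z, True) - ?R z (z, False)"
        using C_pos[OF z, of z] \<rho>(5)[OF z]
        by (simp add: \<rho>(4) mp_index_def marginal_reward_def marginal_resource_def reward[OF z] resource[OF z])
      then show "?R z (z, False) - m z * ?C z (z, False) = ?R z (z, True) - m z * ?C z (z, True)"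
        by (simp add: algebra_simps)
    qed
    from tendsto_minus[OF this] show ?thesis
      unfolding F_def P_def F_eq[OF x] G_eq[OF x] by simp
  qed
  have F_diff: "F differentiable at z" and G_diff: "(\<lambda>z. resource_metric p x (threshold (ereal z))) differentiable at z"
    if "z \<notin> D" for z
    using off_D[OF that] unfolding F_def
    by (auto intro!: differentiable_piecewise[OF F_decomp[OF x] partition(1)[OF x]]
        differentiable_piecewise[OF G_decomp[OF x] partition(1)[OF x]] Fi_diff Gi_diff x)
  have deriv: "deriv (\<lambda>z. - F z) z = m z * deriv P z" if zD: "z \<notin> D" for z
  proof -
    obtain i where "i \<in> N x" "z \<in> interior (S x i)" using off_D[OF zD] by auto
    from deriv_eq[OF x this]
    have "deriv F z = m z * deriv (\<lambda>z. resource_metric p x (threshold (ereal z))) z"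
      by (simp add: F_def[abs_def] m_def)
    then show ?thesis
      using F_diff[OF zD] G_diff[OF zD] unfolding P_def
      by (simp add: deriv_minus field_differentiable_def real_differentiable_def)
  qed
  have "(LINT z:{z\<^sub>1<..z\<^sub>2}|interval_measure P. m z) = - F z\<^sub>2 - - F z\<^sub>1"
  proof (rule stieltjes_integral_eq_increment[OF m_mono m_cont P_mono P_cont _ jump D _ _ deriv z12])
    show "continuous (at_right z) (\<lambda>z. - F z)" for z
      using F_cont by (intro continuous_minus)
    show "(\<lambda>z. - F z) differentiable at z" "P differentiable at z" if "z \<notin> D" for z
      unfolding P_def using F_diff[OF that] G_diff[OF that] by auto
  qed
  \<comment> \<open>The resource metric is decomposed as \<open>0 - P\<close>; the constant part
    gives every interval mass 0, and the sandwich bounds make its integral vanish.\<close>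
  moreover have "(LINT z:{z\<^sub>1<..z\<^sub>2}|interval_measure (\<lambda>_. 0). m z) = 0"
    using set_integral_interval_measure_bounds[OF m_mono, of "\<lambda>_. 0" z\<^sub>1 z\<^sub>2] z12 by (simp add: mono_def)
  ultimately show "has_LS_integral (mp_index_ext p) (\<lambda>z :: real. resource_metric p x (threshold z)) {z\<^sub>1<..z\<^sub>2}
      (reward_metric p x (threshold z\<^sub>2) - reward_metric p x (threshold z\<^sub>1))"
    unfolding has_LS_integral_def m_def[symmetric]
    using P_mono P_cont set_integrable_interval_measure[OF m_mono]
    by (intro exI[of _ "\<lambda>_. 0"] exI[of _ P]) (auto simp: P_def F_def mono_def)
qed

end
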